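(* Let $q\ge 0$ be an integer and let $G$ and $H$ be groups. (i) Let $A\leqslant E^{\wedge}_q(G)$ and $B\leqslant E^{\wedge}_q(H)$ be subgroups. If $G/A\cong H/B$, then $G\wedge^q G\cong H\wedge^q H$. (ii) If $G$ and $H$ are weak $q$-exterior isoclinic, then $M^q(G)\cong M^q(H)$. In particular, if $G$ and $H$ are $q$-exterior isoclinic, then $M^q(G)\cong M^q(H)$.
   Context: Notation: ${}^g h=ghg^{-1}$ and $[g,h]=ghg^{-1}h^{-1}$; $G^q[G,G]$ is the subgroup of $G$ generated by all $q$-th powers and all commutators (for $q=0$ it is $[G,G]$). For $q\geq 1$, the $q$-tensor square $G\otimes^q G$ is the group generated by symbols $g\otimes h$ and $\{(g,g)\}$ ($g,h\in G$) subject to the following relations for all $g,h,g_1,h_1\in G$: (1) $gg_1\otimes h=({}^g g_1\otimes {}^g h)(g\otimes h)$; (2) $g\otimes hh_1=(g\otimes h)({}^h g\otimes {}^h h_1)$; (3) $\{(g,g)\}(g_1\otimes h_1)\{(g,g)\}^{-1}={}^{g^q}g_1\otimes {}^{g^q}h_1$; (4) $\{(gg_1,gg_1)\}=\{(g,g)\}\prod_{i=1}^{q-1}\big(g^{-1}\otimes({}^{g^{1-q+i}}g_1)^i\big)\{(g_1,g_1)\}$ (product in increasing order of $i$); (5) $[\{(g,g)\},\{(g_1,g_1)\}]=g^q\otimes g_1^q$; (6) $\{([g,h],[g,h])\}=(g\otimes h)^q$. For $q=0$, $G\otimes^0 G=G\otimes G$ is the nonabelian tensor square of Brown and Loday: generators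 $g\otimes h$ only, subject to relations (1) and (2). The $q$-exterior square $G\wedge^q G$ is the quotient of $G\otimes^q G$ by the normal subgroup $\nabla^q(G)$ generated by all $g\otimes g$, $g\in G$; the image of $g\otimes h$ is written $g\wedge^q h$ (or $g\wedge h$), and the image of $\{(g,g)\}$ is again written $\{(g,g)\}$. There is a homomorphism $\eta:G\wedge^q G\to G$ with $x\wedge y\mapsto [x,y]$ and (for $q\ge1$) $\{(g,g)\}\mapsto g^q$; its kernel is the $q$-Schur multiplier $M^q(G)$. For $q\ge 1$: $Z^{\wedge}_q(G)=\{g\in G: g\wedge^q h=1 \text{ in } G\wedge^q G\ \forall h\in G\}$ and $E^{\wedge}_q(G)=\{g\in Z^{\wedge}_q(G): \{(g,g)\}=1\in G\wedge^q G\}$. For $q=0$: $E^{\wedge}_0(G)=Z^{\wedge}(G)=\{g\in G: g\wedge h=1 \text{ in } G\wedge^0 G\ \forall h\in G\}$. These are normal (indeed central) subgroups of $G$. Groups $G$ and $H$ are weak $q$-exterior isoclinic if there exist subgroups $A\leqslant E^{\wedge}_q(G)$, $B\leqslant E^{\wedge}_q(H)$ and isomorphisms $\alpha:G/A\to H/B$ and $\beta:G^q[G,G]\to H^q[H,H]$ such that whenever $\alpha(g_1A)=h_1B$ and $\alpha(g_2A)=h_2B$ (with $g_1,g_2\in G$, $h_1,h_2\in H$), one has $\beta([g_1,g_2])=[h_1,h_2]$ and $\beta(g_1^q)=h_1^q$. They are $q$-exterior isoclinic if this holds with $A=E^{\wedge}_q(G)$ and $B=E^{\wedge}_q(H)$.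 *)

theory Defs
  imports "HOL-Algebra.Generated_Groups"
begin

section \<open>Groups presented by generators and relations\<close>

text \<open>A word over \<open>X\<close> is a list of pairs: \<open>(x, True)\<close> stands for the generator \<open>x\<close> and
  \<open>(x, False)\<close> for its formal inverse.\<close>

type_synonym 'g word = "('g \<times> bool) list"

abbreviation words :: "'g set \<Rightarrow> 'g word set"
  where "words X \<equiv> lists (X \<times> UNIV)"

text \<open>The least congruence on the words over \<open>X\<close> that cancels adjacent inverse letters and
  identifies the two sides of every relation in \<open>R\<close>.\<close>

inductive pres_eq :: "'g set \<Rightarrow> ('g word \<times> 'g word) set \<Rightarrow> 'g word \<Rightarrow> 'g word \<Rightarrow> bool"
  for X R where
  refl: "w \<in> words X \<Longrightarrow> pres_eq X R w w"
| sym: "pres_eq X R u v \<Longrightarrow> pres_eq X R v u"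
| trans: "pres_eq X R u v \<Longrightarrow> pres_eq X R v w \<Longrightarrow> pres_eq X R u w"
| append: "pres_eq X R u u' \<Longrightarrow> pres_eq X R v v' \<Longrightarrow> pres_eq X R (u @ v) (u' @ v')"
| cancel: "x \<in> X \<Longrightarrow> pres_eq X R [(x, b), (x, \<not> b)] []"
| rel: "(u, v) \<in> R \<Longrightarrow> u \<in> words X \<Longrightarrow> v \<in> words X \<Longrightarrow> pres_eq X R u v"

definition pres_class :: "'g set \<Rightarrow> ('g word \<times> 'g word) set \<Rightarrow> 'g word \<Rightarrow> 'g word set"
  where "pres_class X R w = {v. pres_eq X R w v}"

definition presented_group :: "'g set \<Rightarrow> ('g word \<times> 'g word) set \<Rightarrow> 'g word set monoid"
  where "presented_group X R =
    \<lparr>carrier = pres_class X R ` words X,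
     mult = (\<lambda>A B. \<Union>u\<in>A. \<Union>v\<in>B. pres_class X R (u @ v)),
     one = pres_class X R []\<rparr>"

lemma pres_eq_words: "pres_eq X R u v \<Longrightarrow> u \<in> words X \<and> v \<in> words X"
  by (induction rule: pres_eq.induct) auto

lemma pres_class_eq_iff:
  assumes "u \<in> words X"
  shows "pres_class X R u = pres_class X R v \<longleftrightarrow> pres_eq X R u v"
proof
  assume "pres_class X R u = pres_class X R v"
  moreover have "u \<in> pres_class X R u"
    using assms by (simp add: pres_class_def pres_eq.refl)
  ultimately show "pres_eq X R u v"
    by (simp add: pres_class_def pres_eq.sym)
next
  assume "pres_eq X R u v"
  then show "pres_class X R u = pres_class X R v"
    by (auto simp: pres_class_def intro: pres_eq.sym pres_eq.trans)
qed

lemma pres_mult_class: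
  assumes "u \<in> words X" "v \<in> words X"
  shows "pres_class X R u \<otimes>\<^bsub>presented_group X R\<^esub> pres_class X R v = pres_class X R (u @ v)"
proof -
  have "pres_class X R (u' @ v') = pres_class X R (u @ v)"
    if "pres_eq X R u u'" "pres_eq X R v v'" for u' v'
    using that by (metis pres_class_eq_iff pres_eq.append pres_eq.sym pres_eq_words)
  moreover have "u \<in> pres_class X R u" "v \<in> pres_class X R v"
    using assms by (simp_all add: pres_class_def pres_eq.refl)
  ultimately have "(\<Union>u'\<in>pres_class X R u. \<Union>v'\<in>pres_class X R v. pres_class X R (u' @ v'))
      = pres_class X R (u @ v)"
    unfolding pres_class_def[of X R u] pres_class_def[of X R v] by blast
  then show ?thesis
    by (simp add: presented_group_def)
qed

definition word_inv :: "'g word \<Rightarrow> 'g word"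
  where "word_inv w = rev (map (\<lambda>(x, b). (x, \<not> b)) w)"

lemma word_inv_words: "w \<in> words X \<Longrightarrow> word_inv w \<in> words X"
  by (auto simp: word_inv_def)

lemma pres_eq_inv_left: "w \<in> words X \<Longrightarrow> pres_eq X R (word_inv w @ w) []"
proof (induction w)
  case Nil
  then show ?case by (simp add: word_inv_def pres_eq.refl)
next
  case (Cons a w)
  obtain x b where a: "a = (x, b)" by (cases a)
  have x: "x \<in> X" and w: "w \<in> words X" using Cons.prems a by auto
  have "pres_eq X R ([(x, \<not> b), (x, b)] @ w) ([] @ w)"
    using pres_eq.append[OF pres_eq.cancel[OF x, of R "\<not> b"] pres_eq.refl[OF w]] by simp
  then have "pres_eq X R (word_inv w @ ([(x, \<not> b), (x, b)] @ w)) (word_inv w @ ([] @ w))"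
    using pres_eq.append[OF pres_eq.refl[OF word_inv_words[OF w]]] by blast
  then show ?case
    using Cons.IH[OF w] by (simp add: a word_inv_def) (blast intro: pres_eq.trans)
qed

theorem group_presented_group: "group (presented_group X R)"
proof (rule groupI)
  let ?P = "presented_group X R"
  have carr: "carrier ?P = pres_class X R ` words X" and one: "\<one>\<^bsub>?P\<^esub> = pres_class X R []"
    by (simp_all add: presented_group_def)
  show "\<one>\<^bsub>?P\<^esub> \<in> carrier ?P" by (simp add: carr one)
  fix A assume "A \<in> carrier ?P"
  then obtain u where u: "u \<in> words X" "A = pres_class X R u" by (auto simp: carr)
  show "\<one>\<^bsub>?P\<^esub> \<otimes>\<^bsub>?P\<^esub> A = A"
    using u by (simp add: one pres_mult_class)
  have "pres_class X R (word_inv u) \<otimes>\<^bsub>?P\<^esub> A = \<one>\<^bsub>?P\<^esub>"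
    using u word_inv_words[OF u(1)] pres_eq_inv_left[OF u(1), of R]
    by (simp add: one pres_mult_class pres_class_eq_iff)
  then show "\<exists>B\<in>carrier ?P. B \<otimes>\<^bsub>?P\<^esub> A = \<one>\<^bsub>?P\<^esub>"
    using word_inv_words[OF u(1)] by (auto simp: carr)
  fix B assume "B \<in> carrier ?P"
  then obtain v where v: "v \<in> words X" "B = pres_class X R v" by (auto simp: carr)
  show "A \<otimes>\<^bsub>?P\<^esub> B \<in> carrier ?P"
    using u v by (auto simp: carr pres_mult_class)
  fix C assume "C \<in> carrier ?P"
  then obtain w where w: "w \<in> words X" "C = pres_class X R w" by (auto simp: carr)
  show "A \<otimes>\<^bsub>?P\<^esub> B \<otimes>\<^bsub>?P\<^esub> C = A \<otimes>\<^bsub>?P\<^esub> (B \<otimes>\<^bsub>?P\<^esub> C)"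
    using u v w by (simp add: pres_mult_class)
qed

definition word_eval :: "('a, 'm) monoid_scheme \<Rightarrow> ('g \<Rightarrow> 'a) \<Rightarrow> 'g word \<Rightarrow> 'a"
  where "word_eval G f w =
    foldr (\<lambda>(x, b) a. (if b then f x else inv\<^bsub>G\<^esub> f x) \<otimes>\<^bsub>G\<^esub> a) w \<one>\<^bsub>G\<^esub>"

definition normal_closure :: "('a, 'm) monoid_scheme \<Rightarrow> 'a set \<Rightarrow> 'a set"
  where "normal_closure G S = \<Inter>{N. N \<lhd> G \<and> S \<subseteq> N}"


section \<open>The q-tensor square and the q-exterior square\<close>

definition conj_by :: "('a, 'm) monoid_scheme \<Rightarrow> 'a \<Rightarrow> 'a \<Rightarrow> 'a"
  where "conj_by G g h = g \<otimes>\<^bsub>G\<^esub> h \<otimes>\<^bsub>G\<^esub> inv\<^bsub>G\<^esub> g"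

definition commutator :: "('a, 'm) monoid_scheme \<Rightarrow> 'a \<Rightarrow> 'a \<Rightarrow> 'a"
  where "commutator G g h = g \<otimes>\<^bsub>G\<^esub> h \<otimes>\<^bsub>G\<^esub> inv\<^bsub>G\<^esub> g \<otimes>\<^bsub>G\<^esub> inv\<^bsub>G\<^esub> h"

text \<open>\<open>Tensor g h\<close> is the symbol \<open>g \<otimes> h\<close> and \<open>Diag g\<close> is the symbol \<open>{(g, g)}\<close>.\<close>

datatype 'a qsymbol = Tensor 'a 'a | Diag 'a

definition qtensor_gens :: "nat \<Rightarrow> ('a, 'm) monoid_scheme \<Rightarrow> 'a qsymbol set"
  where "qtensor_gens q G =
    {Tensor g h | g h. g \<in> carrier G \<and> h \<in> carrier G} \<union>
    (if q = 0 then {} else {Diag g | g. g \<in> carrier G})"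

inductive_set qtensor_rels ::
    "nat \<Rightarrow> ('a, 'm) monoid_scheme \<Rightarrow> ('a qsymbol word \<times> 'a qsymbol word) set"
  for q and G where
  tensor_mult_left:
    "\<lbrakk>g \<in> carrier G; g1 \<in> carrier G; h \<in> carrier G\<rbrakk> \<Longrightarrow>
     ([(Tensor (g \<otimes>\<^bsub>G\<^esub> g1) h, True)],
      [(Tensor (conj_by G g g1) (conj_by G g h), True), (Tensor g h, True)]) \<in> qtensor_rels q G"
| tensor_mult_right:
    "\<lbrakk>g \<in> carrier G; h \<in> carrier G; h1 \<in> carrier G\<rbrakk> \<Longrightarrow>
     ([(Tensor g (h \<otimes>\<^bsub>G\<^esub> h1), True)],
      [(Tensor g h, True), (Tensor (conj_by G h g) (conj_by G h h1), True)]) \<in> qtensor_rels q G"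
| diag_conj:
    "\<lbrakk>q \<ge> 1; g \<in> carrier G; g1 \<in> carrier G; h1 \<in> carrier G\<rbrakk> \<Longrightarrow>
     ([(Diag g, True), (Tensor g1 h1, True), (Diag g, False)],
      [(Tensor (conj_by G (g [^]\<^bsub>G\<^esub> q) g1) (conj_by G (g [^]\<^bsub>G\<^esub> q) h1), True)])
     \<in> qtensor_rels q G"
| diag_mult: \<comment> \<open>the exponent \<open>1 - q + i\<close> is a (nonpositive) integer\<close>
    "\<lbrakk>q \<ge> 1; g \<in> carrier G; g1 \<in> carrier G\<rbrakk> \<Longrightarrow>
     ([(Diag (g \<otimes>\<^bsub>G\<^esub> g1), True)],
      [(Diag g, True)] @
      map (\<lambda>i. (Tensor (inv\<^bsub>G\<^esub> g) (conj_by G (g [^]\<^bsub>G\<^esub> (1 - int q + int i)) g1 [^]\<^bsub>G\<^esub> i), True))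
        [1..<q] @
      [(Diag g1, True)]) \<in> qtensor_rels q G"
| diag_commutator:
    "\<lbrakk>q \<ge> 1; g \<in> carrier G; g1 \<in> carrier G\<rbrakk> \<Longrightarrow>
     ([(Diag g, True), (Diag g1, True), (Diag g, False), (Diag g1, False)],
      [(Tensor (g [^]\<^bsub>G\<^esub> q) (g1 [^]\<^bsub>G\<^esub> q), True)]) \<in> qtensor_rels q G"
| commutator_diag:
    "\<lbrakk>q \<ge> 1; g \<in> carrier G; h \<in> carrier G\<rbrakk> \<Longrightarrow>
     ([(Diag (commutator G g h), True)], replicate q (Tensor g h, True)) \<in> qtensor_rels q G"

definition qtensor_square :: "nat \<Rightarrow> ('a, 'm) monoid_scheme \<Rightarrow> 'a qsymbol word set monoid"
  where "qtensor_square q G = presented_group (qtensor_gens q G) (qtensor_rels q G)"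

definition qtensor_gen :: "nat \<Rightarrow> ('a, 'm) monoid_scheme \<Rightarrow> 'a qsymbol \<Rightarrow> 'a qsymbol word set"
  where "qtensor_gen q G s = pres_class (qtensor_gens q G) (qtensor_rels q G) [(s, True)]"

definition qnabla :: "nat \<Rightarrow> ('a, 'm) monoid_scheme \<Rightarrow> 'a qsymbol word set set"
  where "qnabla q G =
    normal_closure (qtensor_square q G) {qtensor_gen q G (Tensor g g) | g. g \<in> carrier G}"

definition qexterior_square :: "nat \<Rightarrow> ('a, 'm) monoid_scheme \<Rightarrow> 'a qsymbol word set set monoid"
  where "qexterior_square q G = qtensor_square q G Mod qnabla q G"

definition qexterior_gen ::
    "nat \<Rightarrow> ('a, 'm) monoid_scheme \<Rightarrow> 'a qsymbol \<Rightarrow> 'a qsymbol word set set"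
  where "qexterior_gen q G s = qnabla q G #>\<^bsub>qtensor_square q G\<^esub> qtensor_gen q G s"


section \<open>The q-Schur multiplier\<close>

fun qsymbol_eval :: "nat \<Rightarrow> ('a, 'm) monoid_scheme \<Rightarrow> 'a qsymbol \<Rightarrow> 'a"
  where
    "qsymbol_eval q G (Tensor g h) = commutator G g h"
  | "qsymbol_eval q G (Diag g) = g [^]\<^bsub>G\<^esub> q"

text \<open>The homomorphism \<open>\<eta>\<close> is induced on classes, first of words and then of elements of the
  tensor square, by evaluating a representative; see \<open>qtensor_eta_class\<close>, \<open>qexterior_eta_coset\<close>
  and \<open>qexterior_eta_hom\<close> below.\<close>

definition qtensor_eta :: "nat \<Rightarrow> ('a, 'm) monoid_scheme \<Rightarrow> 'a qsymbol word set \<Rightarrow> 'a"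
  where "qtensor_eta q G A = the_elem (word_eval G (qsymbol_eval q G) ` A)"

definition qexterior_eta :: "nat \<Rightarrow> ('a, 'm) monoid_scheme \<Rightarrow> 'a qsymbol word set set \<Rightarrow> 'a"
  where "qexterior_eta q G C = the_elem (qtensor_eta q G ` C)"

definition qSchur_multiplier ::
    "nat \<Rightarrow> ('a, 'm) monoid_scheme \<Rightarrow> 'a qsymbol word set set monoid"
  where "qSchur_multiplier q G =
    (qexterior_square q G)\<lparr>carrier := kernel (qexterior_square q G) G (qexterior_eta q G)\<rparr>"


section \<open>Isoclinism\<close>

definition qexterior_center :: "nat \<Rightarrow> ('a, 'm) monoid_scheme \<Rightarrow> 'a set" \<comment> \<open>\<open>Z\<^sup>\<and>\<^sub>q(G)\<close>\<close>
  where "qexterior_center q G =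
    {g \<in> carrier G. \<forall>h\<in>carrier G. qexterior_gen q G (Tensor g h) = \<one>\<^bsub>qexterior_square q G\<^esub>}"

definition qexterior_E :: "nat \<Rightarrow> ('a, 'm) monoid_scheme \<Rightarrow> 'a set" \<comment> \<open>\<open>E\<^sup>\<and>\<^sub>q(G)\<close>\<close>
  where "qexterior_E q G =
    {g \<in> qexterior_center q G.
      q \<ge> 1 \<longrightarrow> qexterior_gen q G (Diag g) = \<one>\<^bsub>qexterior_square q G\<^esub>}"

text \<open>\<open>G\<^sup>q[G,G]\<close>; for \<open>q = 0\<close> all \<open>q\<close>-th powers are trivial and this is \<open>[G,G]\<close>.\<close>

definition power_commutator_subgroup :: "nat \<Rightarrow> ('a, 'm) monoid_scheme \<Rightarrow> 'a set"
  where "power_commutator_subgroup q G =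
    generate G ({g [^]\<^bsub>G\<^esub> q | g. g \<in> carrier G} \<union>
      {commutator G g h | g h. g \<in> carrier G \<and> h \<in> carrier G})"

definition qisoclinic_modulo ::
    "nat \<Rightarrow> ('a, 'm) monoid_scheme \<Rightarrow> 'a set \<Rightarrow> ('b, 'n) monoid_scheme \<Rightarrow> 'b set \<Rightarrow> bool"
  where "qisoclinic_modulo q G A H B \<longleftrightarrow>
    (\<exists>\<alpha> \<in> iso (G Mod A) (H Mod B).
     \<exists>\<beta> \<in> iso (G\<lparr>carrier := power_commutator_subgroup q G\<rparr>)
               (H\<lparr>carrier := power_commutator_subgroup q H\<rparr>).
       \<forall>g1\<in>carrier G. \<forall>g2\<in>carrier G. \<forall>h1\<in>carrier H. \<forall>h2\<in>carrier H.
         \<alpha> (A #>\<^bsub>G\<^esub> g1) = B #>\<^bsub>H\<^esub> h1 \<and> \<alpha> (A #>\<^bsub>G\<^esub> g2) = B #>\<^bsub>H\<^esub> h2 \<longrightarrow>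
         \<beta> (commutator G g1 g2) = commutator H h1 h2 \<and>
         \<beta> (g1 [^]\<^bsub>G\<^esub> q) = h1 [^]\<^bsub>H\<^esub> q)"

definition weak_qexterior_isoclinic ::
    "nat \<Rightarrow> ('a, 'm) monoid_scheme \<Rightarrow> ('b, 'n) monoid_scheme \<Rightarrow> bool"
  where "weak_qexterior_isoclinic q G H \<longleftrightarrow>
    (\<exists>A B. subgroup A G \<and> A \<subseteq> qexterior_E q G \<and>
           subgroup B H \<and> B \<subseteq> qexterior_E q H \<and> qisoclinic_modulo q G A H B)"

definition qexterior_isoclinic ::
    "nat \<Rightarrow> ('a, 'm) monoid_scheme \<Rightarrow> ('b, 'n) monoid_scheme \<Rightarrow> bool"
  where "qexterior_isoclinic q G H \<longleftrightarrow>
    qisoclinic_modulo q G (qexterior_E q G) H (qexterior_E q H)"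


section \<open>Well-definedness of \<open>\<eta>\<close>\<close>

context group
begin

lemma inv_cancel:
  assumes "x \<in> carrier G" "z \<in> carrier G"
  shows "x \<otimes> (inv x \<otimes> z) = z" "inv x \<otimes> (x \<otimes> z) = z"
  using assms by (simp_all add: m_assoc[symmetric])

lemma normal_closure_normal: "S \<subseteq> carrier G \<Longrightarrow> normal_closure G S \<lhd> G"
proof -
  assume S: "S \<subseteq> carrier G"
  let ?F = "{N. N \<lhd> G \<and> S \<subseteq> N}"
  have ne: "?F \<noteq> {}"
  proof -
    have "carrier G \<lhd> G"
      by (rule normal_invI) (simp_all add: subgroup_self)
    then show ?thesis using S by blast
  qed
  have "subgroup (\<Inter>?F) G"
    by (rule subgroups_Inter[OF _ ne]) (auto dest: normal_imp_subgroup)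
  then show ?thesis
    unfolding normal_closure_def
    by (rule normal_invI) (auto intro: normal.inv_op_closed2)
qed

lemma normal_closure_subset_kernel:
  assumes "group H" "f \<in> hom G H" "S \<subseteq> kernel G H f"
  shows "normal_closure G S \<subseteq> kernel G H f"
proof -
  interpret group_hom G H f
    using assms group_axioms by (simp add: group_hom_def group_hom_axioms_def)
  show ?thesis
    using normal_kernel assms(3) unfolding normal_closure_def by blast
qed

lemma word_eval_closed:
  assumes "f ` X \<subseteq> carrier G" "w \<in> words X"
  shows "word_eval G f w \<in> carrier G"
  using assms(2)
proof (induction w)
  case (Cons a w)
  then show ?case using assms(1) by (cases a) (auto simp: word_eval_def)
qed (simp add: word_eval_def)

lemma word_eval_append:
  assumes "f ` X \<subseteq> carrier G" "u \<in> words X" "v \<in> words X"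
  shows "word_eval G f (u @ v) = word_eval G f u \<otimes> word_eval G f v"
  using assms(2)
proof (induction u rule: list.induct)
  case Nil
  then show ?case using word_eval_closed[OF assms(1,3)] by (simp add: word_eval_def)
next
  case (Cons a u)
  obtain x b where a: "a = (x, b)" by (cases a)
  have x: "f x \<in> carrier G" and u: "u \<in> words X" using Cons.prems assms(1) a by auto
  show ?case
    using Cons.IH[OF u] word_eval_closed[OF assms(1) u] word_eval_closed[OF assms(1,3)] x
    by (simp add: word_eval_def a m_assoc)
qed

lemma word_eval_pres_eq:
  assumes f: "f ` X \<subseteq> carrier G"
    and R: "\<And>u v. (u, v) \<in> R \<Longrightarrow> word_eval G f u = word_eval G f v"
  shows "pres_eq X R u v \<Longrightarrow> word_eval G f u = word_eval G f v"
proof (induction rule: pres_eq.induct)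
  case (append u u' v v')
  then show ?case using word_eval_append[OF f] pres_eq_words by metis
next
  case (cancel x b)
  then have "f x \<in> carrier G" using f by auto
  then show ?case by (simp add: word_eval_def)
qed (use R in auto)

lemma power_expansion:
  assumes x: "x \<in> carrier G" and y: "y \<in> carrier G" and q: "q \<ge> 1"
  shows "(x \<otimes> y) [^] q = x [^] q \<otimes>
    (foldr (\<lambda>i a. commutator G (inv x) (conj_by G (x [^] (1 - int q + int i)) y [^] i) \<otimes> a)
      [1..<q] \<one> \<otimes> y [^] q)"
proof -
  define t where "t i = commutator G (inv x) (conj_by G (x [^] (1 - int q + int i)) y [^] i)" for i :: nat
  have conj_pow: "conj_by G a b [^] i = a \<otimes> b [^] i \<otimes> inv a"
    if ab: "a \<in> carrier G" "b \<in> carrier G" for a b and i :: nat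
  proof (induction i)
    case (Suc i)
    have "a \<otimes> b [^] i \<otimes> inv a \<otimes> (a \<otimes> b \<otimes> inv a) = a \<otimes> (b [^] i \<otimes> b) \<otimes> inv a"
      using ab by (simp add: m_assoc inv_cancel)
    then show ?case using Suc by (simp add: conj_by_def)
  qed (use ab in simp)
  have tc: "t i \<in> carrier G" for i
    using x y by (simp add: t_def commutator_def conj_by_def)
  have cl: "foldr (\<lambda>i a. t i \<otimes> a) is a \<in> carrier G" if "a \<in> carrier G" for "is" a
    using that tc by (induction "is") auto
  have split: "foldr (\<lambda>i a. t i \<otimes> a) is a = foldr (\<lambda>i a. t i \<otimes> a) is \<one> \<otimes> a"
    if "a \<in> carrier G" for "is" a
    using that cl tc by (induction "is") (auto simp: m_assoc)
  have t_eq: "t i = x [^] (int i - int q) \<otimes> (y [^] i \<otimes> (x \<otimes> (inv (y [^] i) \<otimes> x [^] (int q - int i - 1))))" for i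
  proof -
    define c where "c = x [^] (1 - int q + int i)"
    define d where "d = y [^] i"
    have c: "c \<in> carrier G" and d: "d \<in> carrier G" using x y by (simp_all add: c_def d_def)
    have 1: "x [^] (int i - int q) = inv x \<otimes> c"
      using x int_pow_mult[of x "-1" "1 - int q + int i"] by (simp add: c_def int_pow_neg)
    have 2: "x [^] (int q - int i - 1) = inv c"
      using x int_pow_neg[of x "1 - int q + int i"] by (simp add: c_def algebra_simps)
    have 3: "x \<otimes> c = c \<otimes> x"
      using x int_pow_mult[of x 1 "1 - int q + int i"] int_pow_mult[of x "1 - int q + int i" 1]
      by (simp add: c_def add.commute)
    have "t i = inv x \<otimes> (c \<otimes> d \<otimes> inv c) \<otimes> x \<otimes> inv (c \<otimes> d \<otimes> inv c)"
      using x y c by (simp add: t_def commutator_def conj_pow c_def d_def)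
    also have "\<dots> = inv x \<otimes> (c \<otimes> (d \<otimes> (inv c \<otimes> (x \<otimes> c \<otimes> (inv d \<otimes> inv c)))))"
      using x c d by (simp add: m_assoc inv_mult_group)
    also have "\<dots> = inv x \<otimes> (c \<otimes> (d \<otimes> (x \<otimes> (inv d \<otimes> inv c))))"
    proof -
      have "inv c \<otimes> (c \<otimes> x \<otimes> (inv d \<otimes> inv c)) = x \<otimes> (inv d \<otimes> inv c)"
        using x c d by (simp add: m_assoc inv_cancel)
      then show ?thesis by (simp add: 3)
    qed
    finally show ?thesis using x c d by (simp add: 1 2 d_def[symmetric] m_assoc)
  qed
  have main: "x [^] q \<otimes> foldr (\<lambda>i a. t i \<otimes> a) [1..<Suc k] \<one> =
      (x \<otimes> y) [^] Suc k \<otimes> (inv (y [^] Suc k) \<otimes> x [^] (int q - int k - 1))" for k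
  proof (induction k)
    case 0
    have "x \<otimes> x [^] (int q - 1) = x [^] q"
      using x int_pow_mult[of x 1 "int q - 1"] by (simp add: int_pow_int)
    then show ?case using x y by (simp add: m_assoc inv_cancel)
  next
    case (Suc k)
    define e where "e = x [^] (int q - int (Suc k))"
    define d where "d = y [^] Suc k"
    define p where "p = (x \<otimes> y) [^] Suc k"
    have e: "e \<in> carrier G" and d: "d \<in> carrier G" and p: "p \<in> carrier G"
      using x y by (simp_all add: e_def d_def p_def del: nat_pow_Suc)
    have ie: "x [^] (int (Suc k) - int q) = inv e"
      using x int_pow_neg[of x "int q - int (Suc k)"] by (simp add: e_def)
    define r where "r = x [^] (int q - int (Suc k) - 1)"
    have r: "r \<in> carrier G" using x by (simp add: r_def)
    have "x [^] q \<otimes> foldr (\<lambda>i a. t i \<otimes> a) [1..<Suc (Suc k)] \<one>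
        = x [^] q \<otimes> foldr (\<lambda>i a. t i \<otimes> a) [1..<Suc k] \<one> \<otimes> t (Suc k)"
      using split[of "t (Suc k)" "[1..<Suc k]"] tc cl[of \<one> "[1..<Suc k]"] x
      by (simp add: m_assoc)
    also have "\<dots> = p \<otimes> (inv d \<otimes> e) \<otimes> (inv e \<otimes> (d \<otimes> (x \<otimes> (inv d \<otimes> r))))"
      using Suc.IH t_eq[of "Suc k"] ie
      by (simp add: p_def d_def e_def r_def diff_diff_eq add.commute del: nat_pow_Suc)
    also have "\<dots> = p \<otimes> (x \<otimes> (inv d \<otimes> r))"
    proof -
      show ?thesis using p d e x r by (simp add: m_assoc inv_cancel)
    qed
    also have "\<dots> = (x \<otimes> y) [^] Suc (Suc k) \<otimes> (inv (y [^] Suc (Suc k)) \<otimes> r)"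
    proof -
      have yd: "y [^] Suc (Suc k) = d \<otimes> y" and pp: "(x \<otimes> y) [^] Suc (Suc k) = p \<otimes> (x \<otimes> y)"
        by (simp_all add: d_def p_def)
      show ?thesis
        unfolding yd pp using p d r x y by (simp add: m_assoc inv_mult_group inv_cancel)
    qed
    finally show ?case by (simp only: r_def)
  qed
  obtain k where k: "q = Suc k" using q by (cases q) auto
  have F: "foldr (\<lambda>i a. t i \<otimes> a) [1..<q] \<one> \<in> carrier G" by (rule cl) simp
  have "x [^] q \<otimes> foldr (\<lambda>i a. t i \<otimes> a) [1..<q] \<one> = (x \<otimes> y) [^] q \<otimes> inv (y [^] q)"
    using main[of k] x y by (simp add: k del: nat_pow_Suc)
  then have "x [^] q \<otimes> foldr (\<lambda>i a. t i \<otimes> a) [1..<q] \<one> \<otimes> y [^] q = (x \<otimes> y) [^] q"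
    using x y by (simp add: m_assoc)
  then show ?thesis
    using x y F by (simp add: t_def m_assoc)
qed

lemma qsymbol_eval_closed: "qsymbol_eval q G ` qtensor_gens q G \<subseteq> carrier G"
  by (auto simp: qtensor_gens_def commutator_def)

lemma qtensor_rels_eval:
  assumes "(u, v) \<in> qtensor_rels q G"
  shows "word_eval G (qsymbol_eval q G) u = word_eval G (qsymbol_eval q G) v"
  using assms
proof cases
  case (tensor_mult_left g g1 h)
  then show ?thesis
    by (simp add: word_eval_def commutator_def conj_by_def inv_mult_group m_assoc inv_cancel)
next
  case (tensor_mult_right g h h1)
  then show ?thesis
    by (simp add: word_eval_def commutator_def conj_by_def inv_mult_group m_assoc inv_cancel)
next
  case (diag_conj g g1 h1)
  then show ?thesis
    by (simp add: word_eval_def commutator_def conj_by_def inv_mult_group m_assoc inv_cancel)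
next
  case (diag_mult g g1)
  have *: "foldr ((\<lambda>(x, b) a. (if b then qsymbol_eval q G x else inv qsymbol_eval q G x) \<otimes> a) \<circ>
        (\<lambda>i. (Tensor (inv g) (conj_by G (g [^] (1 - int q + int i)) g1 [^] i), True))) is a =
      foldr (\<lambda>i a. commutator G (inv g) (conj_by G (g [^] (1 - int q + int i)) g1 [^] i) \<otimes> a) is \<one> \<otimes> a \<and>
      foldr (\<lambda>i a. commutator G (inv g) (conj_by G (g [^] (1 - int q + int i)) g1 [^] i) \<otimes> a) is \<one>
        \<in> carrier G"
    if "a \<in> carrier G" for "is" a
    using that diag_mult by (induction "is") (auto simp: commutator_def conj_by_def m_assoc)
  show ?thesis
    using diag_mult *[of "g1 [^] q"] power_expansion[of g g1 q]
    by (simp add: word_eval_def foldr_map)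
next
  case (diag_commutator g g1)
  then show ?thesis
    by (simp add: word_eval_def commutator_def m_assoc)
next
  case (commutator_diag g h)
  define c where "c = commutator G g h"
  have c: "c \<in> carrier G" using commutator_diag by (simp add: c_def commutator_def)
  have "word_eval G (qsymbol_eval q G) (replicate n (Tensor g h, True)) = c [^] n" for n
    using c by (induction n) (auto simp: word_eval_def c_def[symmetric] nat_pow_Suc2[symmetric])
  then show ?thesis using commutator_diag c by (simp add: word_eval_def c_def[symmetric])
qed

lemma qtensor_eta_class:
  assumes "w \<in> words (qtensor_gens q G)"
  shows "qtensor_eta q G (pres_class (qtensor_gens q G) (qtensor_rels q G) w)
    = word_eval G (qsymbol_eval q G) w"
proof -
  let ?C = "pres_class (qtensor_gens q G) (qtensor_rels q G) w"
  have "word_eval G (qsymbol_eval q G) v = word_eval G (qsymbol_eval q G) w" if "v \<in> ?C" for v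
    using that word_eval_pres_eq[OF qsymbol_eval_closed qtensor_rels_eval]
    by (metis mem_Collect_eq pres_class_def)
  moreover have "w \<in> ?C" using assms by (simp add: pres_class_def pres_eq.refl)
  ultimately have "word_eval G (qsymbol_eval q G) ` ?C = {word_eval G (qsymbol_eval q G) w}"
    by blast
  then show ?thesis by (simp add: qtensor_eta_def)
qed

lemma group_qtensor_square: "group (qtensor_square q G)"
  by (simp add: qtensor_square_def group_presented_group)

lemma qtensor_eta_hom: "qtensor_eta q G \<in> hom (qtensor_square q G) G"
proof (rule homI)
  have carr: "carrier (qtensor_square q G) =
      pres_class (qtensor_gens q G) (qtensor_rels q G) ` words (qtensor_gens q G)"
    by (simp add: qtensor_square_def presented_group_def)
  fix A assume "A \<in> carrier (qtensor_square q G)"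
  then obtain u where u: "u \<in> words (qtensor_gens q G)"
    "A = pres_class (qtensor_gens q G) (qtensor_rels q G) u" by (auto simp: carr)
  show "qtensor_eta q G A \<in> carrier G"
    using u word_eval_closed[OF qsymbol_eval_closed u(1)] by (simp add: qtensor_eta_class)
  fix B assume "B \<in> carrier (qtensor_square q G)"
  then obtain v where v: "v \<in> words (qtensor_gens q G)"
    "B = pres_class (qtensor_gens q G) (qtensor_rels q G) v" by (auto simp: carr)
  have uv: "u @ v \<in> words (qtensor_gens q G)" using u v by simp
  show "qtensor_eta q G (A \<otimes>\<^bsub>qtensor_square q G\<^esub> B) = qtensor_eta q G A \<otimes> qtensor_eta q G B"
    using qtensor_eta_class[OF uv] qtensor_eta_class[OF u(1)] qtensor_eta_class[OF v(1)]
      word_eval_append[OF qsymbol_eval_closed u(1) v(1)]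
    by (simp add: u(2) v(2) qtensor_square_def pres_mult_class[OF u(1) v(1)])
qed

lemma qtensor_gen_closed:
  "s \<in> qtensor_gens q G \<Longrightarrow> qtensor_gen q G s \<in> carrier (qtensor_square q G)"
  by (auto simp: qtensor_gen_def qtensor_square_def presented_group_def)

lemma qtensor_eta_gen:
  "s \<in> qtensor_gens q G \<Longrightarrow> qtensor_eta q G (qtensor_gen q G s) = qsymbol_eval q G s"
  unfolding qtensor_gen_def using qsymbol_eval_closed[of q]
  by (subst qtensor_eta_class) (auto simp: word_eval_def)

lemma qnabla_gens_closed:
  "{qtensor_gen q G (Tensor g g) | g. g \<in> carrier G} \<subseteq> carrier (qtensor_square q G)"
proof -
  have "Tensor g g \<in> qtensor_gens q G" if "g \<in> carrier G" for g
    using that by (auto simp: qtensor_gens_def)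
  then show ?thesis using qtensor_gen_closed by auto
qed

lemma qnabla_normal: "qnabla q G \<lhd> qtensor_square q G"
  unfolding qnabla_def by (intro group.normal_closure_normal group_qtensor_square qnabla_gens_closed)

lemma group_qexterior_square: "group (qexterior_square q G)"
  by (simp add: qexterior_square_def normal.factorgroup_is_group[OF qnabla_normal])

lemma qnabla_kernel: "qnabla q G \<subseteq> kernel (qtensor_square q G) G (qtensor_eta q G)"
  unfolding qnabla_def
proof (rule group.normal_closure_subset_kernel[OF group_qtensor_square is_group qtensor_eta_hom])
  have "qtensor_eta q G (qtensor_gen q G (Tensor g g)) = \<one>" if "g \<in> carrier G" for g
  proof -
    have "Tensor g g \<in> qtensor_gens q G" using that by (auto simp: qtensor_gens_def)
    then show ?thesis using that by (simp add: qtensor_eta_gen commutator_def m_assoc)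
  qed
  then show "{qtensor_gen q G (Tensor g g) | g. g \<in> carrier G}
      \<subseteq> kernel (qtensor_square q G) G (qtensor_eta q G)"
    using qnabla_gens_closed unfolding kernel_def by blast
qed

lemma qexterior_eta_coset:
  assumes t: "t \<in> carrier (qtensor_square q G)"
  shows "qexterior_eta q G (qnabla q G #>\<^bsub>qtensor_square q G\<^esub> t) = qtensor_eta q G t"
proof -
  interpret T: group "qtensor_square q G" by (rule group_qtensor_square)
  interpret h: group_hom "qtensor_square q G" G "qtensor_eta q G"
    by unfold_locales (rule qtensor_eta_hom)
  have "qtensor_eta q G s = qtensor_eta q G t"
    if s: "s \<in> qnabla q G #>\<^bsub>qtensor_square q G\<^esub> t" for s
  proof -
    obtain n where n: "n \<in> qnabla q G" "s = n \<otimes>\<^bsub>qtensor_square q G\<^esub> t"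
      using s by (auto simp: r_coset_def)
    then have "n \<in> carrier (qtensor_square q G)" "qtensor_eta q G n = \<one>"
      using qnabla_kernel by (auto simp: kernel_def)
    then show ?thesis using n t by simp
  qed
  moreover have "t \<in> qnabla q G #>\<^bsub>qtensor_square q G\<^esub> t"
    using T.rcos_self[OF t normal_imp_subgroup[OF qnabla_normal]] .
  ultimately have "qtensor_eta q G ` (qnabla q G #>\<^bsub>qtensor_square q G\<^esub> t) = {qtensor_eta q G t}"
    by blast
  then show ?thesis by (simp add: qexterior_eta_def)
qed

theorem qexterior_eta_hom: "qexterior_eta q G \<in> hom (qexterior_square q G) G"
proof (rule homI)
  interpret T: group "qtensor_square q G" by (rule group_qtensor_square)
  interpret h: group_hom "qtensor_square q G" G "qtensor_eta q G"
    by unfold_locales (rule qtensor_eta_hom)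
  interpret N: normal "qnabla q G" "qtensor_square q G" by (rule qnabla_normal)
  fix A assume "A \<in> carrier (qexterior_square q G)"
  then obtain a where a: "a \<in> carrier (qtensor_square q G)"
    "A = qnabla q G #>\<^bsub>qtensor_square q G\<^esub> a"
    by (auto simp: qexterior_square_def FactGroup_def RCOSETS_def)
  show "qexterior_eta q G A \<in> carrier G" using a by (simp add: qexterior_eta_coset)
  fix B assume "B \<in> carrier (qexterior_square q G)"
  then obtain b where b: "b \<in> carrier (qtensor_square q G)"
    "B = qnabla q G #>\<^bsub>qtensor_square q G\<^esub> b"
    by (auto simp: qexterior_square_def FactGroup_def RCOSETS_def)
  show "qexterior_eta q G (A \<otimes>\<^bsub>qexterior_square q G\<^esub> B) = qexterior_eta q G A \<otimes> qexterior_eta q G B"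
    using a b by (simp add: qexterior_square_def FactGroup_def N.rcos_sum qexterior_eta_coset)
qed

theorem qexterior_eta_gen:
  "s \<in> qtensor_gens q G \<Longrightarrow> qexterior_eta q G (qexterior_gen q G s) = qsymbol_eval q G s"
  by (simp add: qexterior_gen_def qexterior_eta_coset qtensor_gen_closed qtensor_eta_gen)

end

end

theory Submission
  imports Defs
begin

text \<open>The q-exterior square does not see \<open>E\<^sup>\<and>\<^sub>q(H)\<close>. If \<open>e\<close> lies in it, then \<open>e\<close> is central,
  because \<open>\<eta>\<close> sends \<open>e \<and> h = 1\<close> to \<open>[e, h]\<close>. The defining relations therefore collapse to
  \<open>eg \<and> h = (g \<and> h)(e \<and> h) = g \<and> h\<close> and \<open>{(eg, eg)} = {(e, e)}{(g, g)} = {(g, g)}\<close>; expanding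
  \<open>eg \<and> eg = 1\<close> gives \<open>g \<and> e = 1\<close>, so the second argument of \<open>\<and>\<close> may be translated as well
  (\<open>rel_symbol_functional\<close> collects the three facts).

  Now let \<open>\<alpha> : G/A \<rightarrow> H/B\<close> be an isomorphism, and call \<open>g\<close> and \<open>h\<close> related when \<open>\<alpha>(Ag) = Bh\<close>. Choosing
  a related element for each \<open>g\<close> gives a map from the generators of \<open>G \<and>\<^sup>q G\<close> to \<open>H \<and>\<^sup>q H\<close> that does
  not depend on the choices. The choice need not be multiplicative, but relatedness is compatible
  with products, inverses and hence with everything from which the defining relations are built.
  So each relation of \<open>G\<close> is related, letter by letter, to a relation of \<open>H\<close>
  (\<open>rel_qtensor_rels\<close>), and the map extends to a homomorphism (\<open>qexterior_transport\<close>). The inverse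
  correspondence yields a homomorphism back, and the two are inverse on generators.

  For the multipliers, the compatibility of \<open>\<alpha>\<close> with \<open>\<beta>\<close> says on generators that the isomorphism
  \<open>\<phi> : G \<and>\<^sup>q G \<rightarrow> H \<and>\<^sup>q H\<close> satisfies \<open>\<eta> \<circ> \<phi> = \<beta> \<circ> \<eta>\<close>. As \<open>\<beta>\<close> is injective on \<open>G\<^sup>q[G,G]\<close>, which contains
  the image of \<open>\<eta>\<close>, it follows that \<open>\<phi>\<close> maps the kernel of \<open>\<eta>\<close> onto the kernel of \<open>\<eta>\<close>. The non-weak
  case is the weak one for \<open>A = E\<^sup>\<and>\<^sub>q(G)\<close> and \<open>B = E\<^sup>\<and>\<^sub>q(H)\<close>, once these are known to be subgroups
  (\<open>qexterior_E_subgroup\<close>).\<close>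

section \<open>The universal property of the q-exterior square\<close>

lemma word_eval_hom:
  assumes "group G" "group K" and \<phi>: "\<phi> \<in> hom G K" and f: "f ` X \<subseteq> carrier G"
    and w: "w \<in> words X" and f': "\<And>x. x \<in> X \<Longrightarrow> f' x = \<phi> (f x)"
  shows "word_eval K f' w = \<phi> (word_eval G f w)"
proof -
  interpret \<phi>: group_hom G K \<phi>
    using assms by (simp add: group_hom_def group_hom_axioms_def)
  show ?thesis
    using w
  proof (induction w)
    case Nil
    then show ?case by (simp add: word_eval_def)
  next
    case (Cons a w)
    obtain x b where a: "a = (x, b)" by (cases a)
    have x: "x \<in> X" and w: "w \<in> words X" using Cons a by auto
    have "f x \<in> carrier G" using f x by auto
    then show ?case
      using Cons.IH \<phi>.G.word_eval_closed[OF f w] f'[OF x]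
      by (auto simp: word_eval_def a)
  qed
qed

lemma subgroup_word_eval:
  assumes "subgroup C G" and "f ` X \<subseteq> C" and "w \<in> words X"
  shows "word_eval G f w \<in> C"
  using assms(3)
proof (induction w)
  case Nil
  then show ?case using assms(1) by (simp add: word_eval_def subgroup.one_closed)
next
  case (Cons a w)
  then show ?case
    using assms(1,2)
    by (cases a) (auto simp: word_eval_def intro!: subgroup.m_closed subgroup.m_inv_closed)
qed

lemma word_eval_presented_group:
  assumes "w \<in> words X"
  shows "word_eval (presented_group X R) (\<lambda>x. pres_class X R [(x, True)]) w = pres_class X R w"
proof -
  let ?P = "presented_group X R"
  interpret P: group ?P by (rule group_presented_group)
  have one: "\<one>\<^bsub>?P\<^esub> = pres_class X R []" by (simp add: presented_group_def)
  have inv: "inv\<^bsub>?P\<^esub> pres_class X R [(x, True)] = pres_class X R [(x, False)]" if "x \<in> X" for x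
  proof (rule P.inv_equality)
    show "pres_class X R [(x, False)] \<otimes>\<^bsub>?P\<^esub> pres_class X R [(x, True)] = \<one>\<^bsub>?P\<^esub>"
      using that pres_eq.cancel[OF that, of R False]
      by (simp add: one pres_mult_class pres_class_eq_iff)
  qed (use that in \<open>auto simp: presented_group_def\<close>)
  show ?thesis
    using assms
  proof (induction w)
    case Nil
    then show ?case by (simp add: word_eval_def one)
  next
    case (Cons a w)
    obtain x b where a: "a = (x, b)" by (cases a)
    have x: "x \<in> X" and w: "w \<in> words X" using Cons a by auto
    have "word_eval ?P (\<lambda>x. pres_class X R [(x, True)]) (a # w) =
        pres_class X R [(x, b)] \<otimes>\<^bsub>?P\<^esub> pres_class X R w"
      using Cons.IH inv[OF x] by (simp add: word_eval_def a)
    also have "\<dots> = pres_class X R (a # w)"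
      using x w by (simp add: pres_mult_class a)
    finally show ?case .
  qed
qed

text \<open>Any representative of a class computes the induced map, because word evaluation is constant
  on the classes of the presentation.\<close>

lemma presented_group_universal:
  assumes K: "group K" and f: "f ` X \<subseteq> carrier K"
    and R: "\<And>u v. (u, v) \<in> R \<Longrightarrow> word_eval K f u = word_eval K f v"
  obtains \<phi> where "\<phi> \<in> hom (presented_group X R) K"
    and "\<And>w. w \<in> words X \<Longrightarrow> \<phi> (pres_class X R w) = word_eval K f w"
proof -
  interpret K: group K by (rule K)
  define \<phi> where "\<phi> A = word_eval K f (SOME w. w \<in> A)" for A
  have \<phi>: "\<phi> (pres_class X R w) = word_eval K f w" if "w \<in> words X" for w
  proof -
    have "w \<in> pres_class X R w" using that by (simp add: pres_class_def pres_eq.refl)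
    then have "(SOME v. v \<in> pres_class X R w) \<in> pres_class X R w" by (rule someI)
    then show ?thesis
      using K.word_eval_pres_eq[OF f R] unfolding \<phi>_def pres_class_def by (metis mem_Collect_eq)
  qed
  have "\<phi> \<in> hom (presented_group X R) K"
  proof (rule homI)
    have carr: "carrier (presented_group X R) = pres_class X R ` words X"
      by (simp add: presented_group_def)
    fix A assume "A \<in> carrier (presented_group X R)"
    then obtain u where u: "u \<in> words X" "A = pres_class X R u" by (auto simp: carr)
    show "\<phi> A \<in> carrier K" using u K.word_eval_closed[OF f] by (simp add: \<phi>)
    fix B assume "B \<in> carrier (presented_group X R)"
    then obtain v where v: "v \<in> words X" "B = pres_class X R v" by (auto simp: carr)
    have "u @ v \<in> words X" using u v by simp
    then show "\<phi> (A \<otimes>\<^bsub>presented_group X R\<^esub> B) = \<phi> A \<otimes>\<^bsub>K\<^esub> \<phi> B"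
      using u v K.word_eval_append[OF f] by (simp add: pres_mult_class \<phi>)
  qed
  then show thesis using \<phi> that by blast
qed

context group
begin

lemma conj_by_closed [simp]: "g \<in> carrier G \<Longrightarrow> h \<in> carrier G \<Longrightarrow> conj_by G g h \<in> carrier G"
  by (simp add: conj_by_def)

lemma commutator_closed [simp]: "g \<in> carrier G \<Longrightarrow> h \<in> carrier G \<Longrightarrow> commutator G g h \<in> carrier G"
  by (simp add: commutator_def)

lemma Tensor_in_qtensor_gens [simp]:
  "Tensor g h \<in> qtensor_gens q G \<longleftrightarrow> g \<in> carrier G \<and> h \<in> carrier G"
  by (auto simp: qtensor_gens_def)

lemma Diag_in_qtensor_gens [simp]:
  "Diag g \<in> qtensor_gens q G \<longleftrightarrow> q \<ge> 1 \<and> g \<in> carrier G"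
  by (auto simp: qtensor_gens_def)

lemma qtensor_rels_words:
  "(u, v) \<in> qtensor_rels q G \<Longrightarrow> u \<in> words (qtensor_gens q G) \<and> v \<in> words (qtensor_gens q G)"
  by (erule qtensor_rels.cases) (auto simp: in_lists_conv_set)

lemma qexterior_gen_closed [simp]:
  "s \<in> qtensor_gens q G \<Longrightarrow> qexterior_gen q G s \<in> carrier (qexterior_square q G)"
  using qtensor_gen_closed[of s q]
  by (auto simp: qexterior_gen_def qexterior_square_def FactGroup_def RCOSETS_def)

lemma qexterior_gen_image:
  "qexterior_gen q G ` qtensor_gens q G \<subseteq> carrier (qexterior_square q G)"
  by auto

lemma qexterior_proj_hom:
  "(#>\<^bsub>qtensor_square q G\<^esub>) (qnabla q G) \<in> hom (qtensor_square q G) (qexterior_square q G)"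
  unfolding qexterior_square_def by (rule normal.r_coset_hom_Mod[OF qnabla_normal])

lemma word_eval_qexterior_gen:
  assumes "w \<in> words (qtensor_gens q G)"
  shows "word_eval (qexterior_square q G) (qexterior_gen q G) w =
    qnabla q G #>\<^bsub>qtensor_square q G\<^esub> pres_class (qtensor_gens q G) (qtensor_rels q G) w"
proof -
  have f: "qtensor_gen q G ` qtensor_gens q G \<subseteq> carrier (qtensor_square q G)"
    using qtensor_gen_closed by auto
  have "qtensor_gen q G = (\<lambda>x. pres_class (qtensor_gens q G) (qtensor_rels q G) [(x, True)])"
    by (simp add: qtensor_gen_def fun_eq_iff)
  then have "word_eval (qtensor_square q G) (qtensor_gen q G) w =
      pres_class (qtensor_gens q G) (qtensor_rels q G) w"
    using word_eval_presented_group[OF assms] by (simp add: qtensor_square_def)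
  then show ?thesis
    using word_eval_hom[OF group_qtensor_square group_qexterior_square qexterior_proj_hom f assms]
    by (simp add: qexterior_gen_def)
qed

lemma qexterior_rels:
  assumes "(u, v) \<in> qtensor_rels q G"
  shows "word_eval (qexterior_square q G) (qexterior_gen q G) u =
    word_eval (qexterior_square q G) (qexterior_gen q G) v"
proof -
  have uv: "u \<in> words (qtensor_gens q G)" "v \<in> words (qtensor_gens q G)"
    using qtensor_rels_words[OF assms] by auto
  then have "pres_class (qtensor_gens q G) (qtensor_rels q G) u =
      pres_class (qtensor_gens q G) (qtensor_rels q G) v"
    using pres_eq.rel[OF assms] by (simp add: pres_class_eq_iff)
  then show ?thesis using uv by (simp add: word_eval_qexterior_gen)
qed

lemma qexterior_gen_alternating:
  assumes "g \<in> carrier G"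
  shows "qexterior_gen q G (Tensor g g) = \<one>\<^bsub>qexterior_square q G\<^esub>"
proof -
  have "qtensor_gen q G (Tensor g g) \<in> qnabla q G"
    using assms unfolding qnabla_def normal_closure_def by auto
  then have "qnabla q G #>\<^bsub>qtensor_square q G\<^esub> qtensor_gen q G (Tensor g g) = qnabla q G"
    using normal_imp_subgroup[OF qnabla_normal]
      group.coset_join2[OF group_qtensor_square qtensor_gen_closed] assms by simp
  then show ?thesis
    by (simp add: qexterior_gen_def qexterior_square_def FactGroup_def)
qed

lemma qexterior_generated:
  assumes "x \<in> carrier (qexterior_square q G)"
  obtains w where "w \<in> words (qtensor_gens q G)"
    and "x = word_eval (qexterior_square q G) (qexterior_gen q G) w"
proof -
  from assms obtain w where "w \<in> words (qtensor_gens q G)"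
    "x = qnabla q G #>\<^bsub>qtensor_square q G\<^esub> pres_class (qtensor_gens q G) (qtensor_rels q G) w"
    by (auto simp: qexterior_square_def FactGroup_def RCOSETS_def qtensor_square_def
        presented_group_def)
  then show thesis using that word_eval_qexterior_gen by simp
qed

text \<open>The standard way to identify two homomorphisms out of the exterior square; it serves for the two
  inverse laws and for the square relating \<open>\<eta>\<close> to \<open>\<beta>\<close>.\<close>

lemma qexterior_hom_eqI:
  assumes K: "group K" and \<phi>: "\<phi> \<in> hom (qexterior_square q G) K"
    and \<psi>: "\<psi> \<in> hom (qexterior_square q G) K"
    and eq: "\<And>s. s \<in> qtensor_gens q G \<Longrightarrow> \<phi> (qexterior_gen q G s) = \<psi> (qexterior_gen q G s)"
    and x: "x \<in> carrier (qexterior_square q G)"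
  shows "\<phi> x = \<psi> x"
proof -
  obtain w where w: "w \<in> words (qtensor_gens q G)"
    "x = word_eval (qexterior_square q G) (qexterior_gen q G) w"
    using qexterior_generated[OF x] by blast
  show ?thesis
    using word_eval_hom[OF group_qexterior_square K \<phi> qexterior_gen_image w(1) eq[symmetric]]
      word_eval_hom[OF group_qexterior_square K \<psi> qexterior_gen_image w(1) HOL.refl]
    by (simp add: w(2))
qed

text \<open>The universal property of the presentation, followed by that of the quotient: since \<open>f\<close> kills
  every \<open>g \<otimes> g\<close>, the induced map kills the normal closure of these elements.\<close>

lemma qexterior_universal:
  assumes K: "group K" and f: "f ` qtensor_gens q G \<subseteq> carrier K"
    and R: "\<And>u v. (u, v) \<in> qtensor_rels q G \<Longrightarrow> word_eval K f u = word_eval K f v"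
    and alt: "\<And>g. g \<in> carrier G \<Longrightarrow> f (Tensor g g) = \<one>\<^bsub>K\<^esub>"
  shows "\<exists>\<phi>\<in>hom (qexterior_square q G) K. \<forall>s\<in>qtensor_gens q G. \<phi> (qexterior_gen q G s) = f s"
proof -
  interpret K: group K by (rule K)
  obtain \<theta> where \<theta>: "\<theta> \<in> hom (qtensor_square q G) K"
    and \<theta>w: "\<And>w. w \<in> words (qtensor_gens q G) \<Longrightarrow>
      \<theta> (pres_class (qtensor_gens q G) (qtensor_rels q G) w) = word_eval K f w"
    using presented_group_universal[OF K f R] unfolding qtensor_square_def by blast
  interpret \<theta>: group_hom "qtensor_square q G" K \<theta>
    using \<theta> group_qtensor_square K by (simp add: group_hom_def group_hom_axioms_def)
  have \<theta>g: "\<theta> (qtensor_gen q G s) = f s" if "s \<in> qtensor_gens q G" for s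
  proof -
    have "f s \<in> carrier K" using f that by auto
    then show ?thesis using \<theta>w[of "[(s, True)]"] that by (simp add: qtensor_gen_def word_eval_def)
  qed
  have ker: "qnabla q G \<subseteq> kernel (qtensor_square q G) K \<theta>"
    unfolding qnabla_def
  proof (rule \<theta>.G.normal_closure_subset_kernel[OF K \<theta>])
    show "{qtensor_gen q G (Tensor g g) | g. g \<in> carrier G} \<subseteq> kernel (qtensor_square q G) K \<theta>"
      using qtensor_gen_closed alt by (auto simp: kernel_def \<theta>g)
  qed
  obtain \<phi> where \<phi>: "\<phi> \<in> hom (qtensor_square q G Mod qnabla q G) K"
    and \<phi>c: "\<And>x. x \<in> carrier (qtensor_square q G) \<Longrightarrow>
      \<phi> (qnabla q G #>\<^bsub>qtensor_square q G\<^esub> x) = \<theta> x"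
    using \<theta>.FactGroup_universal_kernel[OF qnabla_normal ker] by blast
  show ?thesis
  proof (intro bexI ballI)
    show "\<phi> \<in> hom (qexterior_square q G) K" using \<phi> by (simp add: qexterior_square_def)
    show "\<phi> (qexterior_gen q G s) = f s" if "s \<in> qtensor_gens q G" for s
      using \<phi>c[OF qtensor_gen_closed[OF that]] \<theta>g[OF that] by (simp add: qexterior_gen_def)
  qed
qed

section \<open>The exterior center\<close>

lemma qexterior_center_closed: "z \<in> qexterior_center q G \<Longrightarrow> z \<in> carrier G"
  by (simp add: qexterior_center_def)

lemma qexterior_mult_left:
  assumes "g \<in> carrier G" "g1 \<in> carrier G" "h \<in> carrier G"
  shows "qexterior_gen q G (Tensor (g \<otimes> g1) h) =
    qexterior_gen q G (Tensor (conj_by G g g1) (conj_by G g h)) \<otimes>\<^bsub>qexterior_square q G\<^esub>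
    qexterior_gen q G (Tensor g h)"
proof -
  interpret E: group "qexterior_square q G" by (rule group_qexterior_square)
  show ?thesis
    using qexterior_rels[OF qtensor_rels.tensor_mult_left[OF assms, of q]] assms
    by (simp add: word_eval_def)
qed

lemma qexterior_mult_right:
  assumes "g \<in> carrier G" "h \<in> carrier G" "h1 \<in> carrier G"
  shows "qexterior_gen q G (Tensor g (h \<otimes> h1)) =
    qexterior_gen q G (Tensor g h) \<otimes>\<^bsub>qexterior_square q G\<^esub>
    qexterior_gen q G (Tensor (conj_by G h g) (conj_by G h h1))"
proof -
  interpret E: group "qexterior_square q G" by (rule group_qexterior_square)
  show ?thesis
    using qexterior_rels[OF qtensor_rels.tensor_mult_right[OF assms, of q]] assms
    by (simp add: word_eval_def)
qed

text \<open>\<open>\<eta>\<close> maps \<open>z \<and> h = 1\<close> to the commutator \<open>[z, h]\<close>.\<close>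

lemma qexterior_center_central:
  assumes z: "z \<in> qexterior_center q G" and h: "h \<in> carrier G"
  shows "z \<otimes> h = h \<otimes> z"
proof -
  interpret \<eta>: group_hom "qexterior_square q G" G "qexterior_eta q G"
    using qexterior_eta_hom group_qexterior_square is_group
    by (simp add: group_hom_def group_hom_axioms_def)
  have zc: "z \<in> carrier G" by (rule qexterior_center_closed[OF z])
  have "commutator G z h = \<one>"
    using qexterior_eta_gen[of "Tensor z h" q] z h zc by (simp add: qexterior_center_def)
  then have "(z \<otimes> h) \<otimes> inv (h \<otimes> z) = \<one>"
    using zc h by (simp add: commutator_def inv_mult_group m_assoc)
  then show ?thesis using zc h inv_equality[of "z \<otimes> h" "inv (h \<otimes> z)"] by simp
qed

lemma qexterior_center_conj:
  assumes z: "z \<in> qexterior_center q G" and h: "h \<in> carrier G"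
  shows "conj_by G z h = h" and "conj_by G h z = z"
proof -
  have zc: "z \<in> carrier G" by (rule qexterior_center_closed[OF z])
  show "conj_by G z h = h"
    unfolding conj_by_def qexterior_center_central[OF z h] using zc h by (simp add: m_assoc)
  show "conj_by G h z = z"
    unfolding conj_by_def qexterior_center_central[OF z h, symmetric]
    using zc h by (simp add: m_assoc)
qed

text \<open>Conjugation by a central element is trivial, so the first tensor relation reads
  \<open>zg \<and> h = (g \<and> h)(z \<and> h)\<close>.\<close>

lemma qexterior_translate_left:
  assumes z: "z \<in> qexterior_center q G" and g: "g \<in> carrier G" and h: "h \<in> carrier G"
  shows "qexterior_gen q G (Tensor (z \<otimes> g) h) = qexterior_gen q G (Tensor g h)"
proof -
  interpret E: group "qexterior_square q G" by (rule group_qexterior_square)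
  have "qexterior_gen q G (Tensor z h) = \<one>\<^bsub>qexterior_square q G\<^esub>"
    using z h by (simp add: qexterior_center_def)
  then show ?thesis
    using qexterior_mult_left[OF qexterior_center_closed[OF z] g h, of q] g h
    by (simp add: qexterior_center_conj[OF z])
qed

text \<open>The definition of the exterior center only concerns left arguments. The right ones follow from
  the alternating law: \<open>1 = zg \<and> zg = g \<and> zg = (g \<and> z)(g \<and> g) = g \<and> z\<close>.\<close>

lemma qexterior_center_right:
  assumes z: "z \<in> qexterior_center q G" and g: "g \<in> carrier G"
  shows "qexterior_gen q G (Tensor g z) = \<one>\<^bsub>qexterior_square q G\<^esub>"
proof -
  interpret E: group "qexterior_square q G" by (rule group_qexterior_square)
  have zc: "z \<in> carrier G" by (rule qexterior_center_closed[OF z])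
  have "\<one>\<^bsub>qexterior_square q G\<^esub> = qexterior_gen q G (Tensor (z \<otimes> g) (z \<otimes> g))"
    using zc g by (simp add: qexterior_gen_alternating)
  also have "\<dots> = qexterior_gen q G (Tensor g (z \<otimes> g))"
    using zc g by (simp add: qexterior_translate_left[OF z])
  also have "\<dots> = qexterior_gen q G (Tensor g z)"
    using qexterior_mult_right[OF g zc g, of q] zc g
    by (simp add: qexterior_center_conj[OF z g] qexterior_gen_alternating)
  finally show ?thesis by simp
qed

lemma qexterior_translate_right:
  assumes z: "z \<in> qexterior_center q G" and g: "g \<in> carrier G" and h: "h \<in> carrier G"
  shows "qexterior_gen q G (Tensor g (z \<otimes> h)) = qexterior_gen q G (Tensor g h)"
proof -
  interpret E: group "qexterior_square q G" by (rule group_qexterior_square)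
  show ?thesis
    using qexterior_mult_right[OF g qexterior_center_closed[OF z] h, of q] g h
    by (simp add: qexterior_center_conj[OF z] qexterior_center_right[OF z])
qed

lemma qexterior_one_center: "\<one> \<in> qexterior_center q G"
proof -
  interpret E: group "qexterior_square q G" by (rule group_qexterior_square)
  have "qexterior_gen q G (Tensor \<one> h) = \<one>\<^bsub>qexterior_square q G\<^esub>" if "h \<in> carrier G" for h
    using qexterior_mult_left[of \<one> \<one> h q] that by (simp add: conj_by_def)
  then show ?thesis by (simp add: qexterior_center_def)
qed

lemma qexterior_center_inv:
  assumes z: "z \<in> qexterior_center q G"
  shows "inv z \<in> qexterior_center q G"
proof -
  have zc: "z \<in> carrier G" by (rule qexterior_center_closed[OF z])
  have "qexterior_gen q G (Tensor (inv z) h) = \<one>\<^bsub>qexterior_square q G\<^esub>" if h: "h \<in> carrier G" for h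
    using qexterior_translate_left[OF z _ h, of "inv z"] zc qexterior_one_center h
    by (simp add: qexterior_center_def)
  then show ?thesis using zc by (simp add: qexterior_center_def)
qed

lemma qexterior_center_mult:
  assumes z: "z \<in> qexterior_center q G" and z': "z' \<in> qexterior_center q G"
  shows "z \<otimes> z' \<in> qexterior_center q G"
  using assms qexterior_translate_left[OF z] by (simp add: qexterior_center_def)

text \<open>Every factor of the product in the relation for \<open>{(zg, zg)}\<close> has the form \<open>inv z \<and> x\<close>, which
  vanishes because the exterior center is closed under inverses.\<close>

lemma qexterior_Diag_mult:
  assumes q: "q \<ge> 1" and z: "z \<in> qexterior_center q G" and g: "g \<in> carrier G"
  shows "qexterior_gen q G (Diag (z \<otimes> g)) =
    qexterior_gen q G (Diag z) \<otimes>\<^bsub>qexterior_square q G\<^esub> qexterior_gen q G (Diag g)"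
proof -
  interpret E: group "qexterior_square q G" by (rule group_qexterior_square)
  have zc: "z \<in> carrier G" by (rule qexterior_center_closed[OF z])
  define t where "t i = Tensor (inv z) (conj_by G (z [^] (1 - int q + int i)) g [^] i)" for i
  have t: "qexterior_gen q G (t i) = \<one>\<^bsub>qexterior_square q G\<^esub>" for i
    using qexterior_center_inv[OF z] zc g by (simp add: t_def qexterior_center_def)
  have *: "word_eval (qexterior_square q G) (qexterior_gen q G) (map (\<lambda>i. (t i, True)) is @ [(Diag g, True)])
      = qexterior_gen q G (Diag g)" for "is"
    using t q g by (induction "is") (simp_all add: word_eval_def)
  have "word_eval (qexterior_square q G) (qexterior_gen q G) [(Diag (z \<otimes> g), True)] =
      qexterior_gen q G (Diag z) \<otimes>\<^bsub>qexterior_square q G\<^esub>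
      word_eval (qexterior_square q G) (qexterior_gen q G)
        (map (\<lambda>i. (t i, True)) [1..<q] @ [(Diag g, True)])"
    using qexterior_rels[OF qtensor_rels.diag_mult[OF q zc g]]
    by (simp add: word_eval_def t_def)
  then show ?thesis using q zc g unfolding * by (simp add: word_eval_def)
qed

lemma qexterior_E_subgroup: "subgroup (qexterior_E q G) G"
proof (rule subgroupI)
  interpret E: group "qexterior_square q G" by (rule group_qexterior_square)
  have D1: "qexterior_gen q G (Diag \<one>) = \<one>\<^bsub>qexterior_square q G\<^esub>" if "q \<ge> 1"
    using qexterior_Diag_mult[OF that qexterior_one_center, of \<one>] that by simp
  show "qexterior_E q G \<subseteq> carrier G"
    by (auto simp: qexterior_E_def qexterior_center_closed)
  show "qexterior_E q G \<noteq> {}"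
    using D1 qexterior_one_center by (auto simp: qexterior_E_def)
  fix a assume a: "a \<in> qexterior_E q G"
  then have az: "a \<in> qexterior_center q G" and ac: "a \<in> carrier G"
    by (auto simp: qexterior_E_def qexterior_center_closed)
  have aD: "qexterior_gen q G (Diag a) = \<one>\<^bsub>qexterior_square q G\<^esub>" if "q \<ge> 1"
    using a that by (simp add: qexterior_E_def)
  have "qexterior_gen q G (Diag (inv a)) = \<one>\<^bsub>qexterior_square q G\<^esub>" if "q \<ge> 1"
    using qexterior_Diag_mult[OF that az, of "inv a"] D1[OF that] aD[OF that] that ac by simp
  then show "inv a \<in> qexterior_E q G"
    using qexterior_center_inv[OF az] by (simp add: qexterior_E_def)
  fix b assume b: "b \<in> qexterior_E q G"
  then have bz: "b \<in> qexterior_center q G" and bc: "b \<in> carrier G"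
    by (auto simp: qexterior_E_def qexterior_center_closed)
  have "qexterior_gen q G (Diag b) = \<one>\<^bsub>qexterior_square q G\<^esub>" if "q \<ge> 1"
    using b that by (simp add: qexterior_E_def)
  then have "qexterior_gen q G (Diag (a \<otimes> b)) = \<one>\<^bsub>qexterior_square q G\<^esub>" if "q \<ge> 1"
    using qexterior_Diag_mult[OF that az bc] aD[OF that] that by simp
  then show "a \<otimes> b \<in> qexterior_E q G"
    using qexterior_center_mult[OF az bz] by (simp add: qexterior_E_def)
qed

lemma qexterior_E_subgroup_normal:
  assumes "subgroup A G" "A \<subseteq> qexterior_E q G"
  shows "A \<lhd> G"
proof (rule normal_invI[OF assms(1)])
  fix x h assume x: "x \<in> carrier G" and h: "h \<in> A"
  then have "conj_by G x h = h"
    using assms(2) by (intro qexterior_center_conj) (auto simp: qexterior_E_def)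
  then show "x \<otimes> h \<otimes> inv x \<in> A" using h by (simp add: conj_by_def)
qed

end

section \<open>Transport along a correspondence of quotients\<close>

text \<open>An isomorphism of quotients, seen as a relation between elements: the relation records all
  pairs of representatives of corresponding cosets, so that no section of the quotient map has to be
  fixed. Swapping the two groups then amounts to taking the converse relation.\<close>

locale qexterior_correspondence = G: group G + H: group H
  for q :: nat and G :: "('a, 'm) monoid_scheme" and H :: "('b, 'n) monoid_scheme" +
  fixes rel :: "'a \<Rightarrow> 'b \<Rightarrow> bool"
  assumes rel_closed: "rel g h \<Longrightarrow> g \<in> carrier G \<and> h \<in> carrier H"
    and rel_total: "g \<in> carrier G \<Longrightarrow> \<exists>h. rel g h"
    and rel_mult: "rel g h \<Longrightarrow> rel g' h' \<Longrightarrow> rel (g \<otimes>\<^bsub>G\<^esub> g') (h \<otimes>\<^bsub>H\<^esub> h')"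
    and rel_inv: "rel g h \<Longrightarrow> rel (inv\<^bsub>G\<^esub> g) (inv\<^bsub>H\<^esub> h)"
    and rel_functional: "rel g h \<Longrightarrow> rel g h' \<Longrightarrow> \<exists>e\<in>qexterior_E q H. h' = e \<otimes>\<^bsub>H\<^esub> h"
begin

lemma rel_one: "rel \<one>\<^bsub>G\<^esub> \<one>\<^bsub>H\<^esub>"
proof -
  obtain h where "rel \<one>\<^bsub>G\<^esub> h" using rel_total by blast
  then show ?thesis using rel_mult[OF _ rel_inv] rel_closed by fastforce
qed

lemma rel_pow: "rel g h \<Longrightarrow> rel (g [^]\<^bsub>G\<^esub> (n::nat)) (h [^]\<^bsub>H\<^esub> n)"
  by (induction n) (simp_all add: rel_one rel_mult)

lemma rel_int_pow: "rel g h \<Longrightarrow> rel (g [^]\<^bsub>G\<^esub> (n::int)) (h [^]\<^bsub>H\<^esub> n)"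
  using rel_pow[of g h "nat n"] rel_inv[OF rel_pow[of g h "nat (- n)"]]
  unfolding int_pow_def2 by (auto simp del: pow_nat)

lemma rel_conj: "rel g h \<Longrightarrow> rel g' h' \<Longrightarrow> rel (conj_by G g g') (conj_by H h h')"
  by (simp add: conj_by_def rel_mult rel_inv)

lemma rel_commutator: "rel g h \<Longrightarrow> rel g' h' \<Longrightarrow> rel (commutator G g g') (commutator H h h')"
  by (simp add: commutator_def rel_mult rel_inv)

lemma rel_gens:
  assumes "rel_qsymbol rel s t"
  shows "s \<in> qtensor_gens q G \<longleftrightarrow> t \<in> qtensor_gens q H"
  using assms rel_closed by (cases s; cases t) auto

lemma rel_symbol_total:
  assumes "s \<in> qtensor_gens q G"
  obtains t where "rel_qsymbol rel s t"
proof (cases s)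
  case (Tensor g g')
  then obtain h h' where "rel g h" "rel g' h'" using assms rel_total by (metis G.Tensor_in_qtensor_gens)
  then show ?thesis using Tensor that[of "Tensor h h'"] by simp
next
  case (Diag g)
  then obtain h where "rel g h" using assms rel_total by (metis G.Diag_in_qtensor_gens)
  then show ?thesis using Diag that[of "Diag h"] by simp
qed

text \<open>A symbol may have many related symbols, but they all name the same element of \<open>H \<and>\<^sup>q H\<close>: two
  of them differ by translating their arguments by elements of \<open>E\<^sup>\<and>\<^sub>q(H)\<close>.\<close>

lemma rel_symbol_functional:
  assumes s: "s \<in> qtensor_gens q G" and t: "rel_qsymbol rel s t" and t': "rel_qsymbol rel s t'"
  shows "qexterior_gen q H t' = qexterior_gen q H t"
proof (cases s)
  case (Tensor g g')
  obtain h1 h2 where h: "t = Tensor h1 h2" "rel g h1" "rel g' h2" using t Tensor by (cases t) auto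
  obtain k1 k2 where k: "t' = Tensor k1 k2" "rel g k1" "rel g' k2" using t' Tensor by (cases t') auto
  obtain e1 e2 where e: "e1 \<in> qexterior_E q H" "e2 \<in> qexterior_E q H"
    "k1 = e1 \<otimes>\<^bsub>H\<^esub> h1" "k2 = e2 \<otimes>\<^bsub>H\<^esub> h2"
    using rel_functional h k by blast
  have c: "e1 \<in> qexterior_center q H" "e2 \<in> qexterior_center q H" 
    "h1 \<in> carrier H" "h2 \<in> carrier H"
    using e h rel_closed by (auto simp: qexterior_E_def)
  then show ?thesis
    by (simp add: h k e H.qexterior_translate_left H.qexterior_translate_right
        H.qexterior_center_closed)
next
  case (Diag g)
  interpret E: group "qexterior_square q H" by (rule H.group_qexterior_square)
  have q: "q \<ge> 1" using s Diag by simp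
  obtain h where h: "t = Diag h" "rel g h" using t Diag by (cases t) auto
  obtain k where k: "t' = Diag k" "rel g k" using t' Diag by (cases t') auto
  obtain e where e: "e \<in> qexterior_E q H" "k = e \<otimes>\<^bsub>H\<^esub> h"
    using rel_functional h k by blast
  have "e \<in> qexterior_center q H" "h \<in> carrier H"
    "qexterior_gen q H (Diag e) = \<one>\<^bsub>qexterior_square q H\<^esub>"
    using e h rel_closed q by (auto simp: qexterior_E_def)
  then show ?thesis using q by (simp add: h k e H.qexterior_Diag_mult)
qed

abbreviation rel_word :: "'a qsymbol word \<Rightarrow> 'b qsymbol word \<Rightarrow> bool"
  where "rel_word \<equiv> list_all2 (rel_prod (rel_qsymbol rel) (=))"

text \<open>Each relation is a scheme built from its parameters by the group operations alone. Hence the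
  instance of the same scheme at related parameters is a related pair of words.\<close>

lemma rel_qtensor_rels:
  assumes "(u, v) \<in> qtensor_rels q G"
  obtains u' v' where "(u', v') \<in> qtensor_rels q H" "rel_word u u'" "rel_word v v'"
  using assms
proof cases
  case (tensor_mult_left g g1 h)
  then obtain k k1 l where r: "rel g k" "rel g1 k1" "rel h l" using rel_total by metis
  then have c: "k \<in> carrier H" "k1 \<in> carrier H" "l \<in> carrier H" using rel_closed by auto
  show ?thesis
    by (rule that[OF qtensor_rels.tensor_mult_left[OF c]])
      (use r tensor_mult_left in \<open>simp_all add: rel_mult rel_conj\<close>)
next
  case (tensor_mult_right g h h1)
  then obtain k l l1 where r: "rel g k" "rel h l" "rel h1 l1" using rel_total by metis
  then have c: "k \<in> carrier H" "l \<in> carrier H" "l1 \<in> carrier H" using rel_closed by auto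
  show ?thesis
    by (rule that[OF qtensor_rels.tensor_mult_right[OF c]])
      (use r tensor_mult_right in \<open>simp_all add: rel_mult rel_conj\<close>)
next
  case (diag_conj g g1 h1)
  then obtain k k1 l1 where r: "rel g k" "rel g1 k1" "rel h1 l1" using rel_total by metis
  then have c: "k \<in> carrier H" "k1 \<in> carrier H" "l1 \<in> carrier H" using rel_closed by auto
  show ?thesis
    by (rule that[OF qtensor_rels.diag_conj[OF diag_conj(3) c]])
      (use r diag_conj in \<open>simp_all add: rel_pow rel_conj\<close>)
next
  case (diag_mult g g1)
  then obtain k k1 where r: "rel g k" "rel g1 k1" using rel_total by metis
  then have c: "k \<in> carrier H" "k1 \<in> carrier H" using rel_closed by auto
  show ?thesis
    by (rule that[OF qtensor_rels.diag_mult[OF diag_mult(3) c]])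
      (use r diag_mult in \<open>auto simp: rel_mult rel_inv rel_pow rel_int_pow rel_conj list_all2_map1
        list_all2_map2 intro!: list_all2_appendI list.rel_refl_strong\<close>)
next
  case (diag_commutator g g1)
  then obtain k k1 where r: "rel g k" "rel g1 k1" using rel_total by metis
  then have c: "k \<in> carrier H" "k1 \<in> carrier H" using rel_closed by auto
  show ?thesis
    by (rule that[OF qtensor_rels.diag_commutator[OF diag_commutator(3) c]])
      (use r diag_commutator in \<open>simp_all add: rel_pow\<close>)
next
  case (commutator_diag g h)
  then obtain k l where r: "rel g k" "rel h l" using rel_total by metis
  then have c: "k \<in> carrier H" "l \<in> carrier H" using rel_closed by auto
  show ?thesis
    by (rule that[OF qtensor_rels.commutator_diag[OF commutator_diag(3) c]])
      (use r commutator_diag in \<open>simp_all add: rel_commutator list_all2_conv_all_nth\<close>)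
qed

text \<open>The map on generators picks any related symbol. On a word it evaluates to the value of any
  related word, so the relations that have to be checked are those of \<open>H\<close>, which hold in
  \<open>H \<and>\<^sup>q H\<close>.\<close>

lemma qexterior_transport:
  "\<exists>\<phi>\<in>hom (qexterior_square q G) (qexterior_square q H).
    \<forall>s\<in>qtensor_gens q G. \<forall>t. rel_qsymbol rel s t \<longrightarrow> \<phi> (qexterior_gen q G s) = qexterior_gen q H t"
proof -
  define f where "f s = qexterior_gen q H (SOME t. rel_qsymbol rel s t)" for s
  have f: "f s = qexterior_gen q H t" if "s \<in> qtensor_gens q G" "rel_qsymbol rel s t" for s t
    unfolding f_def by (rule rel_symbol_functional[OF that someI[of "rel_qsymbol rel s", OF that(2)]])
  have fw: "word_eval (qexterior_square q H) f u =
      word_eval (qexterior_square q H) (qexterior_gen q H) u'"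
    if "rel_word u u'" "u \<in> words (qtensor_gens q G)" for u u'
    using that by (induction rule: list_all2_induct) (auto simp: word_eval_def f)
  have "f ` qtensor_gens q G \<subseteq> carrier (qexterior_square q H)"
  proof
    fix x assume "x \<in> f ` qtensor_gens q G"
    then obtain s where s: "s \<in> qtensor_gens q G" "x = f s" by blast
    obtain t where "rel_qsymbol rel s t" using rel_symbol_total[OF s(1)] .
    then show "x \<in> carrier (qexterior_square q H)" using s f rel_gens by simp
  qed
  moreover have "word_eval (qexterior_square q H) f u = word_eval (qexterior_square q H) f v"
    if uv: "(u, v) \<in> qtensor_rels q G" for u v
  proof -
    obtain u' v' where uv': "(u', v') \<in> qtensor_rels q H" and u': "rel_word u u'"
      and v': "rel_word v v'"
      using rel_qtensor_rels[OF uv] .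
    show ?thesis
      using fw[OF u'] fw[OF v'] G.qtensor_rels_words[OF uv] H.qexterior_rels[OF uv'] by simp
  qed
  moreover have "f (Tensor g g) = \<one>\<^bsub>qexterior_square q H\<^esub>" if g: "g \<in> carrier G" for g
  proof -
    obtain h where "rel g h" using rel_total[OF g] ..
    then show ?thesis
      using f[of "Tensor g g" "Tensor h h"] g rel_closed by (simp add: H.qexterior_gen_alternating)
  qed
  ultimately have "\<exists>\<phi>\<in>hom (qexterior_square q G) (qexterior_square q H).
      \<forall>s\<in>qtensor_gens q G. \<phi> (qexterior_gen q G s) = f s"
    by (rule G.qexterior_universal[OF H.group_qexterior_square])
  then show ?thesis using f by metis
qed

end

lemma qexterior_correspondence_Mod:
  assumes G: "group G" and H: "group H" and A: "A \<lhd> G" and B: "B \<lhd> H"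
    and BE: "B \<subseteq> qexterior_E q H" and \<alpha>: "\<alpha> \<in> iso (G Mod A) (H Mod B)"
  shows "qexterior_correspondence q G H
    (\<lambda>g h. g \<in> carrier G \<and> h \<in> carrier H \<and> \<alpha> (A #>\<^bsub>G\<^esub> g) = B #>\<^bsub>H\<^esub> h)"
proof -
  interpret G: group G by (rule G)
  interpret H: group H by (rule H)
  interpret A: normal A G by (rule A)
  interpret B: normal B H by (rule B)
  interpret \<alpha>: group_hom "G Mod A" "H Mod B" \<alpha>
    using \<alpha> A.factorgroup_is_group B.factorgroup_is_group
    by (simp add: group_hom_def group_hom_axioms_def iso_def)
  have carr: "A #>\<^bsub>G\<^esub> g \<in> carrier (G Mod A)" if "g \<in> carrier G" for g
    using that by (auto simp: FactGroup_def RCOSETS_def)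
  show ?thesis
  proof unfold_locales
    fix g assume "g \<in> carrier G"
    then show "\<exists>h. g \<in> carrier G \<and> h \<in> carrier H \<and> \<alpha> (A #>\<^bsub>G\<^esub> g) = B #>\<^bsub>H\<^esub> h"
      using \<alpha>.hom_closed[OF carr] by (auto simp: FactGroup_def RCOSETS_def)
  next
    fix g h g' h'
    assume 1: "g \<in> carrier G \<and> h \<in> carrier H \<and> \<alpha> (A #>\<^bsub>G\<^esub> g) = B #>\<^bsub>H\<^esub> h"
      and 2: "g' \<in> carrier G \<and> h' \<in> carrier H \<and> \<alpha> (A #>\<^bsub>G\<^esub> g') = B #>\<^bsub>H\<^esub> h'"
    then show "g \<otimes>\<^bsub>G\<^esub> g' \<in> carrier G \<and> h \<otimes>\<^bsub>H\<^esub> h' \<in> carrier H \<and>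
        \<alpha> (A #>\<^bsub>G\<^esub> (g \<otimes>\<^bsub>G\<^esub> g')) = B #>\<^bsub>H\<^esub> (h \<otimes>\<^bsub>H\<^esub> h')"
      using \<alpha>.hom_mult[OF carr carr, of g g'] by (simp add: A.rcos_sum B.rcos_sum FactGroup_def)
  next
    fix g h assume 1: "g \<in> carrier G \<and> h \<in> carrier H \<and> \<alpha> (A #>\<^bsub>G\<^esub> g) = B #>\<^bsub>H\<^esub> h"
    then have "B #>\<^bsub>H\<^esub> h \<in> carrier (H Mod B)" by (auto simp: FactGroup_def RCOSETS_def)
    then show "inv\<^bsub>G\<^esub> g \<in> carrier G \<and> inv\<^bsub>H\<^esub> h \<in> carrier H \<and>
        \<alpha> (A #>\<^bsub>G\<^esub> inv\<^bsub>G\<^esub> g) = B #>\<^bsub>H\<^esub> inv\<^bsub>H\<^esub> h"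
      using \<alpha>.hom_inv[OF carr, of g] 1 carr[of g]
      by (simp add: A.inv_FactGroup B.inv_FactGroup A.rcos_inv B.rcos_inv)
  next
    fix g h h' assume 1: "g \<in> carrier G \<and> h \<in> carrier H \<and> \<alpha> (A #>\<^bsub>G\<^esub> g) = B #>\<^bsub>H\<^esub> h"
      and 2: "g \<in> carrier G \<and> h' \<in> carrier H \<and> \<alpha> (A #>\<^bsub>G\<^esub> g) = B #>\<^bsub>H\<^esub> h'"
    have "h' \<in> B #>\<^bsub>H\<^esub> h'" using 2 H.rcos_self B.is_subgroup by blast
    then have "h' \<in> B #>\<^bsub>H\<^esub> h" using 1 2 by simp
    then show "\<exists>e\<in>qexterior_E q H. h' = e \<otimes>\<^bsub>H\<^esub> h" using BE by (auto simp: r_coset_def)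
  qed auto
qed

lemma qexterior_iso_of_correspondences:
  assumes "qexterior_correspondence q G H rel" and "qexterior_correspondence q H G rel\<inverse>\<inverse>"
  shows "\<exists>\<phi>\<in>iso (qexterior_square q G) (qexterior_square q H).
    \<forall>s\<in>qtensor_gens q G. \<forall>t. rel_qsymbol rel s t \<longrightarrow> \<phi> (qexterior_gen q G s) = qexterior_gen q H t"
proof -
  interpret GH: qexterior_correspondence q G H rel by (rule assms(1))
  interpret HG: qexterior_correspondence q H G "rel\<inverse>\<inverse>" by (rule assms(2))
  obtain \<phi> where \<phi>: "\<phi> \<in> hom (qexterior_square q G) (qexterior_square q H)"
    and \<phi>g: "\<forall>s\<in>qtensor_gens q G. \<forall>t. rel_qsymbol rel s t \<longrightarrow>
      \<phi> (qexterior_gen q G s) = qexterior_gen q H t"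
    using GH.qexterior_transport by (elim bexE) (rule that)
  obtain \<psi> where \<psi>: "\<psi> \<in> hom (qexterior_square q H) (qexterior_square q G)"
    and \<psi>g: "\<forall>t\<in>qtensor_gens q H. \<forall>s. rel_qsymbol rel s t \<longrightarrow>
      \<psi> (qexterior_gen q H t) = qexterior_gen q G s"
    using HG.qexterior_transport unfolding qsymbol.rel_conversep conversep_iff
    by (elim bexE) (rule that)
  have "\<psi> (\<phi> x) = x" if x: "x \<in> carrier (qexterior_square q G)" for x
  proof -
    have "(\<psi> \<circ> \<phi>) x = id x"
    proof (rule GH.G.qexterior_hom_eqI[OF GH.G.group_qexterior_square _ _ _ x])
      show "\<psi> \<circ> \<phi> \<in> hom (qexterior_square q G) (qexterior_square q G)"
        using \<phi> \<psi> by (rule hom_compose)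
      show "id \<in> hom (qexterior_square q G) (qexterior_square q G)" by (simp add: hom_def)
      fix s assume s: "s \<in> qtensor_gens q G"
      obtain t where t: "rel_qsymbol rel s t" using GH.rel_symbol_total[OF s] .
      then show "(\<psi> \<circ> \<phi>) (qexterior_gen q G s) = id (qexterior_gen q G s)"
        using s \<phi>g \<psi>g GH.rel_gens by simp
    qed
    then show ?thesis by simp
  qed
  moreover have "\<phi> (\<psi> x) = x" if x: "x \<in> carrier (qexterior_square q H)" for x
  proof -
    have "(\<phi> \<circ> \<psi>) x = id x"
    proof (rule GH.H.qexterior_hom_eqI[OF GH.H.group_qexterior_square _ _ _ x])
      show "\<phi> \<circ> \<psi> \<in> hom (qexterior_square q H) (qexterior_square q H)"
        using \<psi> \<phi> by (rule hom_compose)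
      show "id \<in> hom (qexterior_square q H) (qexterior_square q H)" by (simp add: hom_def)
      fix t assume t: "t \<in> qtensor_gens q H"
      obtain s where "rel_qsymbol rel\<inverse>\<inverse> t s" using HG.rel_symbol_total[OF t] .
      then have "rel_qsymbol rel s t" by (simp add: qsymbol.rel_conversep)
      then show "(\<phi> \<circ> \<psi>) (qexterior_gen q H t) = id (qexterior_gen q H t)"
        using t \<phi>g \<psi>g GH.rel_gens by simp
    qed
    then show ?thesis by simp
  qed
  ultimately have "\<phi> \<in> iso (qexterior_square q G) (qexterior_square q H)"
    using \<phi> \<psi> unfolding group.iso_iff_group_isomorphisms[OF GH.G.group_qexterior_square]
      group_isomorphisms_def by blast
  with \<phi>g show ?thesis by (rule bexI)
qed

text \<open>The converse of the relation given by \<open>\<alpha>\<close> is the one given by its inverse, so both directions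
  of the correspondence are available.\<close>

lemma qexterior_iso_Mod:
  assumes G: "group G" and H: "group H"
    and A: "subgroup A G" "A \<subseteq> qexterior_E q G" and B: "subgroup B H" "B \<subseteq> qexterior_E q H"
    and \<alpha>: "\<alpha> \<in> iso (G Mod A) (H Mod B)"
  shows "\<exists>\<phi>\<in>iso (qexterior_square q G) (qexterior_square q H). \<forall>s\<in>qtensor_gens q G. \<forall>t.
    rel_qsymbol (\<lambda>g h. g \<in> carrier G \<and> h \<in> carrier H \<and> \<alpha> (A #>\<^bsub>G\<^esub> g) = B #>\<^bsub>H\<^esub> h) s t \<longrightarrow>
    \<phi> (qexterior_gen q G s) = qexterior_gen q H t"
proof -
  have nA: "A \<lhd> G" and nB: "B \<lhd> H"
    using group.qexterior_E_subgroup_normal[OF G A] group.qexterior_E_subgroup_normal[OF H B] .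
  define rel where
    "rel g h \<longleftrightarrow> g \<in> carrier G \<and> h \<in> carrier H \<and> \<alpha> (A #>\<^bsub>G\<^esub> g) = B #>\<^bsub>H\<^esub> h" for g h
  define \<alpha>' where "\<alpha>' = inv_into (carrier (G Mod A)) \<alpha>"
  have gA: "group (G Mod A)" by (rule normal.factorgroup_is_group[OF nA])
  have \<alpha>': "\<alpha>' \<in> iso (H Mod B) (G Mod A)"
    unfolding \<alpha>'_def by (rule group.iso_set_sym[OF gA \<alpha>])
  have bij: "bij_betw \<alpha> (carrier (G Mod A)) (carrier (H Mod B))" using \<alpha> by (simp add: iso_def)
  have "rel\<inverse>\<inverse> = (\<lambda>h g. h \<in> carrier H \<and> g \<in> carrier G \<and> \<alpha>' (B #>\<^bsub>H\<^esub> h) = A #>\<^bsub>G\<^esub> g)"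
  proof (intro ext)
    fix h g
    have "\<alpha> (A #>\<^bsub>G\<^esub> g) = B #>\<^bsub>H\<^esub> h \<longleftrightarrow> \<alpha>' (B #>\<^bsub>H\<^esub> h) = A #>\<^bsub>G\<^esub> g"
      if "g \<in> carrier G" "h \<in> carrier H"
    proof -
      have "A #>\<^bsub>G\<^esub> g \<in> carrier (G Mod A)" "B #>\<^bsub>H\<^esub> h \<in> carrier (H Mod B)"
        using that by (auto simp: FactGroup_def RCOSETS_def)
      then show ?thesis
        unfolding \<alpha>'_def using bij by (metis bij_betw_inv_into_left bij_betw_inv_into_right)
    qed
    then show "rel\<inverse>\<inverse> h g \<longleftrightarrow> h \<in> carrier H \<and> g \<in> carrier G \<and> \<alpha>' (B #>\<^bsub>H\<^esub> h) = A #>\<^bsub>G\<^esub> g"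
      by (auto simp: rel_def)
  qed
  then have "qexterior_correspondence q H G rel\<inverse>\<inverse>"
    using qexterior_correspondence_Mod[OF H G nB nA A(2) \<alpha>'] by simp
  moreover have "qexterior_correspondence q G H rel"
    using qexterior_correspondence_Mod[OF G H nA nB B(2) \<alpha>] by (simp add: rel_def[abs_def])
  ultimately show ?thesis
    using qexterior_iso_of_correspondences[of q G H rel] unfolding rel_def[abs_def] by blast
qed

section \<open>Isoclinism and the q-Schur multiplier\<close>

text \<open>The isomorphism of exterior squares restricts to the kernels of \<open>\<eta>\<close> because it intertwines the
  two maps \<open>\<eta>\<close> through \<open>\<beta>\<close>.\<close>

lemma qSchur_multiplier_iso_of_qisoclinic_modulo:
  assumes G: "group G" and H: "group H"
    and A: "subgroup A G" "A \<subseteq> qexterior_E q G" and B: "subgroup B H" "B \<subseteq> qexterior_E q H"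
    and iso: "qisoclinic_modulo q G A H B"
  shows "qSchur_multiplier q G \<cong> qSchur_multiplier q H"
proof -
  interpret G: group G by (rule G)
  interpret H: group H by (rule H)
  let ?C = "power_commutator_subgroup q G" and ?D = "power_commutator_subgroup q H"
  obtain \<alpha> \<beta> where \<alpha>: "\<alpha> \<in> iso (G Mod A) (H Mod B)"
    and \<beta>: "\<beta> \<in> iso (G\<lparr>carrier := ?C\<rparr>) (H\<lparr>carrier := ?D\<rparr>)"
    and comp: "\<forall>g1\<in>carrier G. \<forall>g2\<in>carrier G. \<forall>h1\<in>carrier H. \<forall>h2\<in>carrier H.
      \<alpha> (A #>\<^bsub>G\<^esub> g1) = B #>\<^bsub>H\<^esub> h1 \<and> \<alpha> (A #>\<^bsub>G\<^esub> g2) = B #>\<^bsub>H\<^esub> h2 \<longrightarrow>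
      \<beta> (commutator G g1 g2) = commutator H h1 h2 \<and> \<beta> (g1 [^]\<^bsub>G\<^esub> q) = h1 [^]\<^bsub>H\<^esub> q"
    using iso unfolding qisoclinic_modulo_def by (elim bexE) (rule that)
  let ?rel = "\<lambda>g h. g \<in> carrier G \<and> h \<in> carrier H \<and> \<alpha> (A #>\<^bsub>G\<^esub> g) = B #>\<^bsub>H\<^esub> h"
  interpret R: qexterior_correspondence q G H ?rel
    using qexterior_correspondence_Mod[OF G H G.qexterior_E_subgroup_normal[OF A]
        H.qexterior_E_subgroup_normal[OF B] B(2) \<alpha>] .
  obtain \<phi> where \<phi>: "\<phi> \<in> iso (qexterior_square q G) (qexterior_square q H)"
    and \<phi>g: "\<forall>s\<in>qtensor_gens q G. \<forall>t. rel_qsymbol ?rel s t \<longrightarrow>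
      \<phi> (qexterior_gen q G s) = qexterior_gen q H t"
    using qexterior_iso_Mod[OF G H A B \<alpha>] by (elim bexE) (rule that)
  interpret EG: group "qexterior_square q G" by (rule G.group_qexterior_square)
  interpret EH: group "qexterior_square q H" by (rule H.group_qexterior_square)
  interpret \<eta>: group_hom "qexterior_square q G" G "qexterior_eta q G"
    by unfold_locales (rule G.qexterior_eta_hom)
  interpret \<eta>H: group_hom "qexterior_square q H" H "qexterior_eta q H"
    by unfold_locales (rule H.qexterior_eta_hom)
  have C: "subgroup ?C G"
    unfolding power_commutator_subgroup_def by (rule G.generate_is_subgroup) auto
  have D: "subgroup ?D H"
    unfolding power_commutator_subgroup_def by (rule H.generate_is_subgroup) auto
  have evC: "qsymbol_eval q G s \<in> ?C" if "s \<in> qtensor_gens q G" for s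
    using that unfolding power_commutator_subgroup_def
    by (cases s) (auto intro!: generate.incl)
  have etaC: "qexterior_eta q G x \<in> ?C" if x: "x \<in> carrier (qexterior_square q G)" for x
  proof -
    obtain w where w: "w \<in> words (qtensor_gens q G)"
      "x = word_eval (qexterior_square q G) (qexterior_gen q G) w"
      using G.qexterior_generated[OF x] by blast
    have "word_eval G (qsymbol_eval q G) w = qexterior_eta q G x"
      unfolding w(2)
      by (rule word_eval_hom[OF EG.is_group G \<eta>.homh G.qexterior_gen_image w(1)])
        (simp add: G.qexterior_eta_gen)
    moreover have "word_eval G (qsymbol_eval q G) w \<in> ?C"
      by (rule subgroup_word_eval[OF C _ w(1)]) (use evC in auto)
    ultimately show ?thesis by simp
  qed
  have \<beta>C: "\<beta> c \<in> carrier H" if "c \<in> ?C" for c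
    using that \<beta> subgroup.subset[OF D] by (auto simp: hom_def iso_def)
  have \<beta>\<eta>: "\<beta> \<circ> qexterior_eta q G \<in> hom (qexterior_square q G) H"
    using etaC \<beta>C \<beta> by (auto simp: hom_def iso_def)
  \<comment> \<open>On generators this is exactly the compatibility of \<open>\<alpha>\<close> and \<open>\<beta>\<close> required by isoclinism.\<close>
  have square: "qexterior_eta q H (\<phi> x) = \<beta> (qexterior_eta q G x)"
    if x: "x \<in> carrier (qexterior_square q G)" for x
  proof -
    have "(qexterior_eta q H \<circ> \<phi>) x = (\<beta> \<circ> qexterior_eta q G) x"
    proof (rule G.qexterior_hom_eqI[OF H _ \<beta>\<eta> _ x])
      show "qexterior_eta q H \<circ> \<phi> \<in> hom (qexterior_square q G) H"
        using iso_imp_homomorphism[OF \<phi>] \<eta>H.homh by (rule hom_compose)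
      fix s assume s: "s \<in> qtensor_gens q G"
      obtain t where t: "rel_qsymbol ?rel s t" using R.rel_symbol_total[OF s] .
      then have "t \<in> qtensor_gens q H" using R.rel_gens s by blast
      moreover have "qsymbol_eval q H t = \<beta> (qsymbol_eval q G s)"
        using t comp by (cases s; cases t) auto
      ultimately show "(qexterior_eta q H \<circ> \<phi>) (qexterior_gen q G s) =
          (\<beta> \<circ> qexterior_eta q G) (qexterior_gen q G s)"
        using s t \<phi>g by (simp add: G.qexterior_eta_gen H.qexterior_eta_gen)
    qed
    then show ?thesis by simp
  qed
  have \<beta>1: "\<beta> c = \<one>\<^bsub>H\<^esub> \<longleftrightarrow> c = \<one>\<^bsub>G\<^esub>" if "c \<in> ?C" for c
  proof -
    have "\<beta> \<one>\<^bsub>G\<^esub> = \<one>\<^bsub>H\<^esub>"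
      using hom_one[of \<beta> "G\<lparr>carrier := ?C\<rparr>" "H\<lparr>carrier := ?D\<rparr>"] \<beta>
        subgroup.subgroup_is_group[OF C G] subgroup.subgroup_is_group[OF D H]
      by (simp add: iso_def)
    then show ?thesis
      using \<beta> that subgroup.one_closed[OF C] by (auto simp: iso_def bij_betw_def inj_on_def)
  qed
  let ?M = "kernel (qexterior_square q G) G (qexterior_eta q G)"
  let ?N = "kernel (qexterior_square q H) H (qexterior_eta q H)"
  have bij: "bij_betw \<phi> (carrier (qexterior_square q G)) (carrier (qexterior_square q H))"
    using \<phi> by (simp add: iso_def)
  have ker: "x \<in> ?M \<longleftrightarrow> \<phi> x \<in> ?N" if "x \<in> carrier (qexterior_square q G)" for x
    using that bij_betwE[OF bij] square[OF that] \<beta>1[OF etaC[OF that]] by (simp add: kernel_def)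
  have "\<phi> ` ?M = ?N"
  proof
    show "\<phi> ` ?M \<subseteq> ?N" using ker by (auto simp: kernel_def)
    show "?N \<subseteq> \<phi> ` ?M"
    proof
      fix y assume y: "y \<in> ?N"
      then obtain x where "x \<in> carrier (qexterior_square q G)" "y = \<phi> x"
        using bij by (auto simp: kernel_def bij_betw_def)
      then show "y \<in> \<phi> ` ?M" using y ker by blast
    qed
  qed
  then have "bij_betw \<phi> ?M ?N"
    using bij by (auto simp: bij_betw_def kernel_def intro: inj_on_subset)
  moreover have "\<phi> (x \<otimes>\<^bsub>qexterior_square q G\<^esub> y) = \<phi> x \<otimes>\<^bsub>qexterior_square q H\<^esub> \<phi> y"
    if "x \<in> ?M" "y \<in> ?M" for x y
    using that \<phi> by (auto simp: iso_def hom_def kernel_def)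
  ultimately have "\<phi> \<in> iso (qSchur_multiplier q G) (qSchur_multiplier q H)"
    by (auto simp: qSchur_multiplier_def iso_def hom_def bij_betw_def)
  then show ?thesis by (rule is_isoI)
qed

theorem theorem3p3:
  fixes q :: nat
    and G :: "('a, 'm) monoid_scheme"
    and H :: "('b, 'n) monoid_scheme"
  assumes "group G" and "group H"
  shows "(\<forall>A B. subgroup A G \<and> A \<subseteq> qexterior_E q G \<and>
                subgroup B H \<and> B \<subseteq> qexterior_E q H \<and> (G Mod A) \<cong> (H Mod B) \<longrightarrow>
                qexterior_square q G \<cong> qexterior_square q H) \<and>
         (weak_qexterior_isoclinic q G H \<longrightarrow> qSchur_multiplier q G \<cong> qSchur_multiplier q H) \<and>
         (qexterior_isoclinic q G H \<longrightarrow> qSchur_multiplier q G \<cong> qSchur_multiplier q H)"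
proof (intro conjI allI impI)
  fix A B
  assume AB: "subgroup A G \<and> A \<subseteq> qexterior_E q G \<and>
    subgroup B H \<and> B \<subseteq> qexterior_E q H \<and> (G Mod A) \<cong> (H Mod B)"
  then obtain \<alpha> where \<alpha>: "\<alpha> \<in> iso (G Mod A) (H Mod B)" by (auto simp: is_iso_def)
  then show "qexterior_square q G \<cong> qexterior_square q H"
    using qexterior_iso_Mod[OF assms, of A q B \<alpha>] AB by (auto intro: is_isoI)
next
  assume "weak_qexterior_isoclinic q G H"
  then show "qSchur_multiplier q G \<cong> qSchur_multiplier q H"
    using qSchur_multiplier_iso_of_qisoclinic_modulo[OF assms]
    unfolding weak_qexterior_isoclinic_def by blast
next
  assume "qexterior_isoclinic q G H"
  then show "qSchur_multiplier q G \<cong> qSchur_multiplier q H"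
    using qSchur_multiplier_iso_of_qisoclinic_modulo[OF assms
        group.qexterior_E_subgroup[OF assms(1)] order_refl
        group.qexterior_E_subgroup[OF assms(2)] order_refl]
    unfolding qexterior_isoclinic_def by blast
qed

end
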